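(* Let $\mathbb{B}$ be the open unit ball of a complex Banach space $X$, let $\omega$ and $\mu$ be normal functions, and let $\varphi\in H(\mathbb{B})$. Then $T_{\varphi}:\mathcal{B}_{\mathcal{R}}(\mathbb{B})_{\omega,0}\to\mathcal{B}_{\mathcal{R}}(\mathbb{B})_{\mu,0}$ is bounded if and only if $\varphi\in\mathcal{B}_{\mathcal{R}}(\mathbb{B})_{\mu,0}$ and $$\sup_{z\in\mathbb{B}}\mu(z)|\mathcal{R}\varphi(z)|\int_0^{\|z\|}\frac{1}{\omega(t)}\,dt<\infty.$$
   Context: A positive continuous function $\omega$ on $[0,1)$ is normal if there are constants $\delta\in[0,1)$ and $0<a<b<\infty$ such that on $[\delta,1)$ the function $\omega(r)/(1-r)^a$ is decreasing and $\omega(r)/(1-r)^b$ is increasing. A normal function is extended to $\mathbb{B}$ by $\omega(z)=\omega(\|z\|)$. $H(\mathbb{B})$ is the set of holomorphic functions $\mathbb{B}\to\mathbb{C}$. For $f\in H(\mathbb{B})$, $\mathcal{R}f(z)=Df(z)z$, where $Df(z)$ is the Fréchet derivative of $f$ at $z$. For a normal $\omega$, the Bloch-type space $\mathcal{B}_{\mathcal{R}}(\mathbb{B})_{\omega}$ is the set of $f\in H(\mathbb{B})$ with $\sup_{z\in\mathbb{B}}\omega(z)|\mathcal{R}f(z)|<\infty$, with norm $\|f\|_{\mathcal{R},\omega}=|f(0)|+\sup_{z\in\mathbb{B}}\omega(z)|\mathcal{R}f(z)|$. The little Bloch-type space $\mathcal{B}_{\mathcal{R}}(\mathbb{B})_{\omega,0}$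 is the closed subspace of those $f\in H(\mathbb{B})$ with $\lim_{\|z\|\to1}\omega(z)|\mathcal{R}f(z)|=0$ (the limit being uniform over all $z\in\mathbb{B}$ with $\|z\|\to 1$). For $\varphi\in H(\mathbb{B})$, the extended Cesàro operator is $T_{\varphi}f(z)=\int_0^1 f(tz)\,\mathcal{R}\varphi(tz)\,\frac{1}{t}\,dt$ for $f\in H(\mathbb{B})$, $z\in\mathbb{B}$. Saying that $T_\varphi$ is bounded between two spaces means that it maps the first into the second and is a bounded linear operator. *)

theory Defs
  imports "HOL-Analysis.Analysis"
begin

text \<open>A complex structure on a real normed space that is compatible with its real
  structure and for which the given norm is a complex norm.\<close>

class complex_normed_vector = real_normed_vector +
  fixes scaleC :: "complex \<Rightarrow> 'a \<Rightarrow> 'a"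
  assumes scaleC_add_right: "scaleC c (x + y) = scaleC c x + scaleC c y"
    and scaleC_add_left: "scaleC (c + d) x = scaleC c x + scaleC d x"
    and scaleC_scaleC: "scaleC c (scaleC d x) = scaleC (c * d) x"
    and scaleC_one: "scaleC 1 x = x"
    and scaleR_scaleC: "scaleR r x = scaleC (complex_of_real r) x"
    and norm_scaleC: "norm (scaleC c x) = cmod c * norm x"

class complex_banach = complex_normed_vector + banach

text \<open>Monotonicity is meant in the weak sense. Strict monotonicity would define the same
  class of functions: decrease \<open>a\<close> and increase \<open>b\<close> slightly.\<close>

definition normal_fun :: "(real \<Rightarrow> real) \<Rightarrow> bool" where
  "normal_fun \<omega> \<longleftrightarrow>
     continuous_on {0..<1} \<omega> \<and> (\<forall>r\<in>{0..<1}. \<omega> r > 0) \<and>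
     (\<exists>\<delta> a b. 0 \<le> \<delta> \<and> \<delta> < 1 \<and> 0 < a \<and> a < b \<and>
        antimono_on {\<delta>..<1} (\<lambda>r. \<omega> r / (1 - r) powr a) \<and>
        mono_on {\<delta>..<1} (\<lambda>r. \<omega> r / (1 - r) powr b))"

text \<open>A function on the open unit ball is represented by its extension by \<open>0\<close> to the whole
  space. With this convention the function spaces below are genuine vector spaces under
  pointwise operations, and functions that agree on the ball are equal.\<close>

definition holo_ball :: "('a::complex_normed_vector \<Rightarrow> complex) set" where
  "holo_ball = {f.
     (\<forall>z\<in>ball 0 1. \<exists>D. (f has_derivative D) (at z) \<and> (\<forall>c x. D (scaleC c x) = c * D x)) \<and>
     (\<forall>z. z \<notin> ball 0 1 \<longrightarrow> f z = 0)}"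

definition radial_deriv :: "('a::complex_normed_vector \<Rightarrow> complex) \<Rightarrow> 'a \<Rightarrow> complex" where
  "radial_deriv f z = frechet_derivative f (at z) z"

definition bloch_norm ::
  "(real \<Rightarrow> real) \<Rightarrow> ('a::complex_normed_vector \<Rightarrow> complex) \<Rightarrow> real" where
  "bloch_norm \<omega> f = cmod (f 0) + (SUP z\<in>ball 0 1. \<omega> (norm z) * cmod (radial_deriv f z))"

text \<open>The filter \<open>filtercomap norm (at_left 1)\<close> expresses \<open>\<parallel>z\<parallel> \<rightarrow> 1\<close> with \<open>\<parallel>z\<parallel> < 1\<close>, uniformly
  in \<open>z\<close>. By the maximum principle on one-dimensional discs, the supremum in \<open>bloch_norm\<close> is
  finite on this space.\<close>

definition little_bloch ::
  "(real \<Rightarrow> real) \<Rightarrow> ('a::complex_normed_vector \<Rightarrow> complex) set" where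
  "little_bloch \<omega> = {f \<in> holo_ball.
     ((\<lambda>z. \<omega> (norm z) * cmod (radial_deriv f z)) \<longlongrightarrow> 0) (filtercomap norm (at_left 1))}"

text \<open>The integrand extends continuously to \<open>t = 0\<close>, since the radial derivative of \<open>\<phi>\<close>
  at \<open>t z\<close> is \<open>t\<close> times the derivative of \<open>\<phi>\<close> at \<open>t z\<close> applied to \<open>z\<close>.\<close>

definition cesaro_op ::
  "('a::complex_normed_vector \<Rightarrow> complex) \<Rightarrow> ('a \<Rightarrow> complex) \<Rightarrow> 'a \<Rightarrow> complex" where
  "cesaro_op \<phi> f z =
     (if z \<in> ball 0 1
      then integral {0..1} (\<lambda>t. f (t *\<^sub>R z) * radial_deriv \<phi> (t *\<^sub>R z) * complex_of_real (1 / t))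
      else 0)"

definition bounded_operator_on ::
  "('a \<Rightarrow> complex) set \<Rightarrow> (('a \<Rightarrow> complex) \<Rightarrow> real) \<Rightarrow>
   ('a \<Rightarrow> complex) set \<Rightarrow> (('a \<Rightarrow> complex) \<Rightarrow> real) \<Rightarrow>
   (('a \<Rightarrow> complex) \<Rightarrow> ('a \<Rightarrow> complex)) \<Rightarrow> bool" where
  "bounded_operator_on V N W M T \<longleftrightarrow>
     (\<forall>f\<in>V. T f \<in> W) \<and>
     (\<forall>f\<in>V. \<forall>g\<in>V. T (\<lambda>z. f z + g z) = (\<lambda>z. T f z + T g z)) \<and>
     (\<forall>c. \<forall>f\<in>V. T (\<lambda>z. c * f z) = (\<lambda>z. c * T f z)) \<and>
     (\<exists>C. \<forall>f\<in>V. M (T f) \<le> C * N f)"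

end

theory Submission
  imports Defs "HOL-Complex_Analysis.Conformal_Mappings"
begin

text \<open>Everything rests on \<open>\<R>(T\<^sub>\<phi> f) = f \<cdot> \<R>\<phi>\<close>. Integrating \<open>\<R>f\<close> along rays yields
  \<open>|f z| \<le> |f 0| + C \<parallel>f\<parallel> I(\<parallel>z\<parallel>)\<close> with \<open>I(r) = \<integral>\<^sub>0\<^sup>r 1/\<omega>\<close>, and for \<open>f\<close> in the little space the factor in
  front of \<open>I\<close> may be made arbitrarily small at the cost of a larger additive constant; this gives
  sufficiency. For necessity, \<open>f = 1\<close> shows that \<open>\<phi>\<close> is in the little space, and for each \<open>w\<close> one tests
  \<open>T\<^sub>\<phi>\<close> on the polynomial \<open>\<Sum>\<^sub>k L(z)^(2^k) / (2^k \<omega>(1 - 2^(-k)))\<close> over a finite range of \<open>k\<close>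
  depending on \<open>w\<close>, where \<open>L\<close> is a norming functional of \<open>w\<close>. By normality its Bloch
  norm is bounded independently of the range, while its value at \<open>w\<close> is comparable to
  \<open>I(\<parallel>w\<parallel>)\<close> up to an additive constant.

  That \<open>T\<^sub>\<phi> f\<close> is Frechet holomorphic follows from the fact that locally bounded pointwise limits of
  holomorphic functions are holomorphic, applied to Riemann sums.\<close>

section \<open>Holomorphic functions on complex normed spaces\<close>

text \<open>Balls of a Banach space need not be relatively compact, so uniform bounds are taken near
  compact sets. The segment from 0 to \<open>z\<close> is one, and the integral at \<open>z\<close>
  sees nothing else; one-variable Cauchy estimates along complex lines then give constants
  independent of the direction. The full lacunary series is no test function: along the ray of
  \<open>w\<close> its weighted radial derivative stays away from 0, because
  \<open>(1 - 2^(-k))^(2^k)\<close> does. Polynomials are admissible since \<omega> tends to 0 at 1,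
  but then all bounds must be uniform in the number of terms. The coefficient
  \<open>1 / (2^k \<omega>(1 - 2^(-k)))\<close> dominates, up to a constant, the integral of
  \<open>1 / \<omega>\<close> over \<open>1 - 2^(-k) \<le> t \<le> 1 - 2^(-k-1)\<close>, and the
  exponent \<open>2^k\<close> cancels its factor \<open>2^(-k)\<close> in the radial derivative. In
  the sufficiency the decay at the sphere is the delicate half, since the supremum condition alone
  gives only boundedness. Growth is measured from a sphere beyond which the weighted derivative of
  \<open>f\<close> is small; the bound for \<open>f\<close> on that sphere is a constant, beaten by
  the decay of the weighted derivative of \<phi>.\<close>

definition holo_at :: "('a::complex_normed_vector \<Rightarrow> complex) \<Rightarrow> 'a \<Rightarrow> bool" where
  "holo_at f z \<longleftrightarrow> (\<exists>D. (f has_derivative D) (at z) \<and> (\<forall>c x. D (scaleC c x) = c * D x))"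

lemma holo_ball_iff:
  "f \<in> holo_ball \<longleftrightarrow> (\<forall>z\<in>ball 0 1. holo_at f z) \<and> (\<forall>z. z \<notin> ball 0 1 \<longrightarrow> f z = 0)"
  by (simp add: holo_ball_def holo_at_def)

lemma holo_at_has_derivative:
  assumes "holo_at f z"
  shows "(f has_derivative frechet_derivative f (at z)) (at z)"
  using assms frechet_derivative_works unfolding holo_at_def differentiable_def by blast

lemma holo_at_linear:
  assumes "holo_at f z"
  shows "linear (frechet_derivative f (at z))"
  using holo_at_has_derivative[OF assms] has_derivative_linear by blast

lemma holo_at_scaleC:
  assumes "holo_at f z"
  shows "frechet_derivative f (at z) (scaleC c x) = c * frechet_derivative f (at z) x"
  using assms frechet_derivative_at unfolding holo_at_def by metis

lemma holo_at_continuous: "holo_at f z \<Longrightarrow> isCont f z"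
  using holo_at_has_derivative has_derivative_continuous by blast

section \<open>Restriction to complex lines and Cauchy estimates\<close>

lemma bounded_linear_scaleC_left:
  "bounded_linear (\<lambda>c. scaleC c (h::'a::complex_normed_vector))"
proof (rule bounded_linear_intro[where K = "norm h"])
  show "scaleC (r *\<^sub>R c) h = r *\<^sub>R scaleC c h" for r c
    by (simp add: scaleR_scaleC scaleC_scaleC scaleR_conv_of_real)
qed (simp_all add: scaleC_add_left norm_scaleC)

lemma scaleC_0_left [simp]: "scaleC 0 (h::'a::complex_normed_vector) = 0"
  using bounded_linear.linear[OF bounded_linear_scaleC_left] linear_0 by blast

lemma scaleC_of_real: "scaleC (complex_of_real r) h = r *\<^sub>R (h::'a::complex_normed_vector)"
  by (simp add: scaleR_scaleC)

text \<open>Complex homogeneity of the derivative turns real differentiability on the line into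
  complex differentiability in \<zeta>. All one-variable theorems enter through this
  restriction.\<close>

lemma holo_at_line_derivative:
  assumes "holo_at f (z + scaleC c h)"
  shows "((\<lambda>\<zeta>. f (z + scaleC \<zeta> h)) has_field_derivative
           frechet_derivative f (at (z + scaleC c h)) h) (at c)"
proof -
  let ?D = "frechet_derivative f (at (z + scaleC c h))"
  have "((\<lambda>\<zeta>. z + scaleC \<zeta> h) has_derivative (\<lambda>\<zeta>. scaleC \<zeta> h)) (at c)"
    using bounded_linear.has_derivative[OF bounded_linear_scaleC_left has_derivative_ident]
    by (auto intro!: derivative_eq_intros)
  from has_derivative_compose[OF this holo_at_has_derivative[OF assms]]
  have "((\<lambda>\<zeta>. f (z + scaleC \<zeta> h)) has_derivative (\<lambda>\<zeta>. ?D (scaleC \<zeta> h))) (at c)" .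
  then show ?thesis
    by (simp add: has_field_derivative_def holo_at_scaleC[OF assms] mult_commute_abs)
qed

lemma in_ball_scaleC:
  fixes z h :: "'a::complex_normed_vector"
  assumes "0 < R" "norm h * r \<le> R" "cmod c < r"
  shows "z + scaleC c h \<in> ball z R"
proof (cases "h = 0")
  case False
  then have "cmod c * norm h < r * norm h"
    using assms by simp
  then show ?thesis
    using assms by (simp add: dist_norm norm_scaleC mult.commute)
qed (use assms in \<open>simp add: dist_norm norm_scaleC\<close>)

lemma holomorphic_on_line:
  assumes "\<And>w. w \<in> ball z R \<Longrightarrow> holo_at f w" "0 < R" "norm h * r \<le> R"
  shows "(\<lambda>\<zeta>. f (z + scaleC \<zeta> h)) holomorphic_on ball 0 r"
  unfolding holomorphic_on_open[OF open_ball]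
  using holo_at_line_derivative assms(1) in_ball_scaleC[OF assms(2,3)] by (metis mem_ball_0)

lemma frechet_derivative_le:
  assumes holo: "\<And>w. w \<in> ball z R \<Longrightarrow> holo_at f w"
    and bnd: "\<And>w. w \<in> ball z R \<Longrightarrow> cmod (f w) \<le> M" and "0 < R"
  shows "cmod (frechet_derivative f (at z) h) \<le> 2 * M / R * norm h"
proof (cases "h = 0")
  case True
  then show ?thesis
    using linear_0[OF holo_at_linear] holo[of z] \<open>0 < R\<close> by simp
next
  case False
  \<comment> \<open>Half of the radius on which the line stays in the ball, so that the closed disc
    fits into the domain; this is the source of the factor 2.\<close>
  define r where "r = R / (2 * norm h)"
  have "0 < r" using False \<open>0 < R\<close> by (simp add: r_def)
  let ?u = "\<lambda>\<zeta>. f (z + scaleC \<zeta> h)"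
  have le: "norm h * (2 * r) \<le> R" using False by (simp add: r_def)
  have hol: "?u holomorphic_on ball 0 (2 * r)"
    by (rule holomorphic_on_line[OF holo \<open>0 < R\<close> le])
  have sub: "cball 0 r \<subseteq> ball 0 (2 * r)" using \<open>0 < r\<close> by auto
  have "norm ((deriv ^^ 1) ?u 0) \<le> fact 1 * M / r ^ 1"
  proof (rule Cauchy_inequality[OF _ _ \<open>0 < r\<close>])
    show "?u holomorphic_on ball 0 r"
      using hol sub holomorphic_on_subset by (meson ball_subset_cball order_trans)
    show "continuous_on (cball 0 r) ?u"
      using hol sub holomorphic_on_imp_continuous_on continuous_on_subset by blast
    show "cmod (?u x) \<le> M" if "cmod (0 - x) = r" for x
      using that \<open>0 < r\<close> by (intro bnd in_ball_scaleC[OF \<open>0 < R\<close> le]) simp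
  qed
  moreover have "deriv ?u 0 = frechet_derivative f (at z) h"
    using holo_at_line_derivative[of f z 0 h] holo[of z] \<open>0 < R\<close> DERIV_imp_deriv by force
  ultimately show ?thesis
    using False \<open>0 < R\<close> by (simp add: r_def field_simps)
qed

text \<open>First-order Taylor expansion of \<zeta> \<mapsto>
  \<open>f (z + scaleC \<zeta> h)\<close> from 0 to 1. The second derivative is bounded by Cauchy's
  inequality on discs of radius \<open>\<rho> / 4\<close>, which gives \<open>2 * 16 = 32\<close>.
  The bound knows \<open>f\<close> only through \<open>M\<close>, so it is uniform over
  families.\<close>

lemma frechet_derivative_remainder_le:
  assumes holo: "\<And>w. w \<in> ball z R \<Longrightarrow> holo_at f w"
    and bnd: "\<And>w. w \<in> ball z R \<Longrightarrow> cmod (f w) \<le> M" and "0 < R" and h: "norm h \<le> R / 2"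
  shows "cmod (f (z + h) - f z - frechet_derivative f (at z) h) \<le> 32 * M * (norm h / R)\<^sup>2"
proof (cases "h = 0")
  case True
  then show ?thesis
    using linear_0[OF holo_at_linear] holo[of z] \<open>0 < R\<close> by simp
next
  case False
  define \<rho> where "\<rho> = R / norm h"
  have "2 \<le> \<rho>" using False h by (simp add: \<rho>_def field_simps)
  let ?u = "\<lambda>\<zeta>. f (z + scaleC \<zeta> h)"
  have le: "norm h * \<rho> \<le> R" using False by (simp add: \<rho>_def)
  have hol: "?u holomorphic_on ball 0 \<rho>"
    by (rule holomorphic_on_line[OF holo \<open>0 < R\<close> le])
  have B: "cmod ((deriv ^^ 2) ?u x) \<le> fact 2 * M / (\<rho> / 4) ^ 2" if "x \<in> cball 0 1" for x
  proof (rule Cauchy_inequality)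
    \<comment> \<open>The assumption \<open>norm h \<le> R / 2\<close> means
      \<open>2 \<le> \<rho>\<close>, hence \<open>1 + \<rho> / 4 < \<rho>\<close>.\<close>
    have sub: "cball x (\<rho> / 4) \<subseteq> ball 0 \<rho>"
    proof
      fix y assume "y \<in> cball x (\<rho> / 4)"
      then have "cmod y \<le> 1 + \<rho> / 4"
        using that norm_triangle_ineq2[of y x] by (simp add: dist_norm norm_minus_commute)
      then show "y \<in> ball 0 \<rho>" using \<open>2 \<le> \<rho>\<close> by simp
    qed
    show "?u holomorphic_on ball x (\<rho> / 4)"
      using hol sub holomorphic_on_subset by (meson ball_subset_cball order_trans)
    show "continuous_on (cball x (\<rho> / 4)) ?u"
      using hol sub holomorphic_on_imp_continuous_on continuous_on_subset by blast
    show "cmod (?u y) \<le> M" if "cmod (x - y) = \<rho> / 4" for y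
    proof (rule bnd, rule in_ball_scaleC[OF \<open>0 < R\<close> le])
      show "cmod y < \<rho>" using that sub by (force simp: dist_norm)
    qed
  qed (use \<open>2 \<le> \<rho>\<close> in auto)
  have "cmod ((deriv ^^ 0) ?u 1 - (\<Sum>i\<le>1. (deriv ^^ i) ?u 0 * (1 - 0) ^ i / fact i))
          \<le> fact 2 * M / (\<rho> / 4) ^ 2 * cmod (1 - 0) ^ Suc 1 / fact 1"
  proof (rule complex_Taylor)
    show "((deriv ^^ i) ?u has_field_derivative (deriv ^^ Suc i) ?u x) (at x within cball 0 1)"
      if "x \<in> cball 0 1" for i x
    proof -
      have "x \<in> ball 0 \<rho>" using that \<open>2 \<le> \<rho>\<close> by simp
      then show ?thesis
        using holomorphic_derivI[OF holomorphic_higher_deriv[OF hol open_ball] open_ball]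
        by simp
    qed
    show "cmod ((deriv ^^ Suc 1) ?u x) \<le> fact 2 * M / (\<rho> / 4) ^ 2" if "x \<in> cball 0 1" for x
      using B[OF that] by (simp add: numeral_2_eq_2)
  qed auto
  moreover have "deriv ?u 0 = frechet_derivative f (at z) h"
    using holo_at_line_derivative[of f z 0 h] holo[of z] \<open>0 < R\<close> DERIV_imp_deriv by force
  ultimately show ?thesis
    using False \<open>0 < R\<close>
    by (simp add: \<rho>_def scaleC_one field_simps power2_eq_square diff_diff_eq)
qed

text \<open>The derivatives at \<open>z\<close> form a Cauchy filter because they differ from difference quotients,
  which converge, by a uniformly small amount.\<close>

lemma holo_at_bounded_pointwise_limit:
  fixes g :: "'i \<Rightarrow> 'a::complex_normed_vector \<Rightarrow> complex"
  assumes F: "F \<noteq> bot" and "0 < R"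
    and ev: "\<forall>\<^sub>F i in F. \<forall>w\<in>ball z R. holo_at (g i) w \<and> cmod (g i w) \<le> M"
    and lim: "\<And>w. w \<in> ball z R \<Longrightarrow> ((\<lambda>i. g i w) \<longlongrightarrow> G w) F"
  shows "holo_at G z"
proof -
  define D where "D i = frechet_derivative (g i) (at z)" for i
  have ev_D: "\<forall>\<^sub>F i in F. linear (D i) \<and> (\<forall>c x. D i (scaleC c x) = c * D i x)
      \<and> (\<forall>h. cmod (D i h) \<le> 2 * M / R * norm h)
      \<and> (\<forall>h. norm h \<le> R / 2 \<longrightarrow> cmod (g i (z + h) - g i z - D i h) \<le> 32 * M * (norm h / R)\<^sup>2)"
    using ev
  proof eventually_elim
    case (elim i)
    then have "holo_at (g i) z" using \<open>0 < R\<close> by auto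
    then show ?case
      unfolding D_def using elim \<open>0 < R\<close>
      by (intro conjI allI impI holo_at_linear holo_at_scaleC frechet_derivative_le
          frechet_derivative_remainder_le) auto
  qed
  have "0 \<le> M"
  proof -
    obtain i where "\<forall>w\<in>ball z R. holo_at (g i) w \<and> cmod (g i w) \<le> M"
      using eventually_happens'[OF F ev] by blast
    then show ?thesis using \<open>0 < R\<close> norm_ge_zero order_trans centre_in_ball by metis
  qed
  have "\<exists>l. ((\<lambda>i. D i h) \<longlongrightarrow> l) F" for h
  proof -
    have "cauchy_filter (filtermap (\<lambda>i. D i h) F)"
      unfolding cauchy_filter_metric_filtermap
    proof (intro allI impI)
      fix e :: real assume "0 < e"
      define C where "C = 32 * M * (norm h / R)\<^sup>2"
      have "0 \<le> C" using \<open>0 \<le> M\<close> by (simp add: C_def)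
      \<comment> \<open>The remainder for the increment \<open>s *\<^sub>R h\<close>, divided by
        \<open>s\<close>, is at most \<open>s * C\<close>. The second entry makes this at most
        \<open>e / 4\<close>; the first keeps the increment within \<open>R / 2\<close>.\<close>
      define s where "s = min (R / (2 * (norm h + 1))) (e / (4 * (C + 1)))"
      have "0 < s" using \<open>0 < R\<close> \<open>0 < e\<close> \<open>0 \<le> C\<close> by (auto simp: s_def add_nonneg_pos)
      have "s * norm h \<le> R / (2 * (norm h + 1)) * norm h"
        by (intro mult_right_mono) (auto simp: s_def)
      also have "\<dots> \<le> R / 2" using \<open>0 < R\<close> by (simp add: field_simps add_pos_nonneg)
      finally have s1: "norm (s *\<^sub>R h) \<le> R / 2" using \<open>0 < s\<close> by simp
      have "s * C \<le> e / (4 * (C + 1)) * C"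
        using \<open>0 \<le> C\<close> by (intro mult_right_mono) (auto simp: s_def)
      also have "\<dots> \<le> e / 4" using \<open>0 < e\<close> \<open>0 \<le> C\<close> by (simp add: field_simps add_pos_nonneg)
      finally have s2: "s * C \<le> e / 4" .
      \<comment> \<open>The quotient of the limit function is a common reference point: every late
        \<open>D i h\<close> is close to it, so late values are close to each other.\<close>
      define q where "q = (G (z + s *\<^sub>R h) - G z) / s"
      have "((\<lambda>i. (g i (z + s *\<^sub>R h) - g i z) / s) \<longlongrightarrow> q) F"
        unfolding q_def using s1 \<open>0 < R\<close> \<open>0 < s\<close>
        by (intro tendsto_intros lim) (auto simp: dist_norm)
      then have "\<forall>\<^sub>F i in F. dist ((g i (z + s *\<^sub>R h) - g i z) / s) q < e / 4"
        using \<open>0 < e\<close> tendstoD by (metis divide_pos_pos zero_less_numeral)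
      with ev_D have "\<forall>\<^sub>F i in F. cmod (D i h - q) < e / 2"
      proof eventually_elim
        case (elim i)
        have "cmod (g i (z + s *\<^sub>R h) - g i z - D i (s *\<^sub>R h)) \<le> 32 * M * (norm (s *\<^sub>R h) / R)\<^sup>2"
          using elim(1) s1 by blast
        moreover have "32 * M * (norm (s *\<^sub>R h) / R)\<^sup>2 = s * (s * C)"
          using \<open>0 < s\<close> by (simp add: C_def power2_eq_square)
        moreover have "D i (s *\<^sub>R h) = s * D i h"
          using elim(1) by (metis scaleR_scaleC)
        moreover have "(g i (z + s *\<^sub>R h) - g i z) / s - D i h
            = (g i (z + s *\<^sub>R h) - g i z - s * D i h) / s"
          using \<open>0 < s\<close> by (simp add: field_simps)
        ultimately have "cmod ((g i (z + s *\<^sub>R h) - g i z) / s - D i h) \<le> s * (s * C) / s"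
          using \<open>0 < s\<close> by (simp add: norm_divide divide_le_eq mult_ac)
        also have "\<dots> \<le> e / 4" using s2 \<open>0 < s\<close> by simp
        finally show ?case
          using elim(2) norm_triangle_ineq4[of "(g i (z + s *\<^sub>R h) - g i z) / s - q"
              "(g i (z + s *\<^sub>R h) - g i z) / s - D i h"]
          by (simp add: dist_norm)
      qed
      moreover have "dist (D i h) (D j h) < e" if "cmod (D i h - q) < e / 2" "cmod (D j h - q) < e / 2" for i j
        using that dist_triangle_half_l[of "D i h" q e "D j h"] by (simp add: dist_norm)
      ultimately show "\<exists>P. eventually P F \<and> (\<forall>i j. P i \<and> P j \<longrightarrow> dist (D i h) (D j h) < e)"
        by (intro exI[of _ "\<lambda>i. cmod (D i h - q) < e / 2"]) blast
    qed
    then obtain l where "filtermap (\<lambda>i. D i h) F \<le> nhds l"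
      using cauchy_filter_complete_converges[of "filtermap (\<lambda>i. D i h) F" UNIV] F complete_UNIV
      by (auto simp: filtermap_bot_iff)
    then show ?thesis by (auto simp: filterlim_def)
  qed
  then obtain E where E: "\<And>h. ((\<lambda>i. D i h) \<longlongrightarrow> E h) F" by metis
  have add: "E (x + y) = E x + E y" for x y
  proof (rule tendsto_unique[OF F E])
    show "((\<lambda>i. D i (x + y)) \<longlongrightarrow> E x + E y) F"
      by (rule Lim_transform_eventually[OF tendsto_add[OF E E]])
         (use ev_D in eventually_elim, simp add: linear_add)
  qed
  have scale: "E (scaleC c x) = c * E x" for c x
  proof (rule tendsto_unique[OF F E])
    show "((\<lambda>i. D i (scaleC c x)) \<longlongrightarrow> c * E x) F"
      by (rule Lim_transform_eventually[OF tendsto_mult_left[OF E]])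
         (use ev_D in eventually_elim, simp)
  qed
  have bnd: "cmod (E h) \<le> 2 * M / R * norm h" for h
    by (rule tendsto_upperbound[OF tendsto_norm[OF E] _ F]) (use ev_D in eventually_elim, blast)
  have bl: "bounded_linear E"
  proof (rule bounded_linear_intro[OF add])
    show "E (r *\<^sub>R x) = r *\<^sub>R E x" for r x
      using scale[of "of_real r" x] by (simp add: scaleC_of_real scaleR_conv_of_real)
    show "cmod (E x) \<le> norm x * (2 * M / R)" for x using bnd[of x] by (simp add: mult.commute)
  qed
  \<comment> \<open>The remainder bound is the same for all indices, so it survives the pointwise
    limit; no uniform convergence is needed.\<close>
  have rem: "cmod (G (z + h) - G z - E h) \<le> 32 * M * (norm h / R)\<^sup>2" if "norm h \<le> R / 2" for h
  proof (rule tendsto_upperbound[OF _ _ F])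
    show "((\<lambda>i. cmod (g i (z + h) - g i z - D i h)) \<longlongrightarrow> cmod (G (z + h) - G z - E h)) F"
      using that \<open>0 < R\<close> by (intro tendsto_intros lim E) (auto simp: dist_norm)
    show "\<forall>\<^sub>F i in F. cmod (g i (z + h) - g i z - D i h) \<le> 32 * M * (norm h / R)\<^sup>2"
      using ev_D that by (auto elim: eventually_mono)
  qed
  have "(\<lambda>h. cmod (G (z + h) - G z - E h) / norm h) \<midarrow>0\<rightarrow> 0"
  proof (rule tendsto_sandwich[OF _ _ tendsto_const])
    show "\<forall>\<^sub>F h in at 0. cmod (G (z + h) - G z - E h) / norm h \<le> 32 * M / R\<^sup>2 * norm h"
      unfolding eventually_at
    proof (intro exI[of _ "R / 2"] conjI ballI impI)
      fix h :: 'a assume "h \<noteq> 0 \<and> dist h 0 < R / 2"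
      then show "cmod (G (z + h) - G z - E h) / norm h \<le> 32 * M / R\<^sup>2 * norm h"
        using rem[of h] by (simp add: divide_le_eq power2_eq_square)
    qed (use \<open>0 < R\<close> in simp)
    have "((\<lambda>h::'a. 32 * M / R\<^sup>2 * norm h) \<longlongrightarrow> 32 * M / R\<^sup>2 * norm (0::'a)) (at 0)"
      by (intro tendsto_intros)
    then show "((\<lambda>h::'a. 32 * M / R\<^sup>2 * norm h) \<longlongrightarrow> 0) (at 0)" by simp
  qed simp
  with bl have "(G has_derivative E) (at z)" by (simp add: has_derivative_at)
  with scale show ?thesis by (auto simp: holo_at_def)
qed

section \<open>Closure properties of pointwise holomorphy\<close>

lemma holo_at_transform:
  assumes "holo_at f z" "open S" "z \<in> S" "\<And>w. w \<in> S \<Longrightarrow> f w = g w"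
  shows "holo_at g z"
  using assms has_derivative_transform_within_open unfolding holo_at_def by metis

lemma holo_at_const: "holo_at (\<lambda>z. c) z"
  unfolding holo_at_def by (intro exI[of _ "\<lambda>_. 0"]) simp

lemma holo_at_add:
  assumes "holo_at f z" "holo_at g z"
  shows "holo_at (\<lambda>z. f z + g z) z"
proof -
  obtain D E where D: "(f has_derivative D) (at z)" "\<And>c x. D (scaleC c x) = c * D x"
    and E: "(g has_derivative E) (at z)" "\<And>c x. E (scaleC c x) = c * E x"
    using assms unfolding holo_at_def by blast
  show ?thesis
    unfolding holo_at_def using has_derivative_add[OF D(1) E(1)] D(2) E(2)
    by (intro exI conjI) (auto simp: algebra_simps)
qed

lemma holo_at_diff:
  assumes "holo_at f z" "holo_at g z"
  shows "holo_at (\<lambda>z. f z - g z) z"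
proof -
  obtain D E where D: "(f has_derivative D) (at z)" "\<And>c x. D (scaleC c x) = c * D x"
    and E: "(g has_derivative E) (at z)" "\<And>c x. E (scaleC c x) = c * E x"
    using assms unfolding holo_at_def by blast
  show ?thesis
    unfolding holo_at_def using has_derivative_diff[OF D(1) E(1)] D(2) E(2)
    by (intro exI conjI) (auto simp: algebra_simps)
qed

lemma holo_at_mult:
  assumes "holo_at f z" "holo_at g z"
  shows "holo_at (\<lambda>z. f z * g z) z"
proof -
  obtain D E where D: "(f has_derivative D) (at z)" "\<And>c x. D (scaleC c x) = c * D x"
    and E: "(g has_derivative E) (at z)" "\<And>c x. E (scaleC c x) = c * E x"
    using assms unfolding holo_at_def by blast
  have "((\<lambda>z. f z * g z) has_derivative (\<lambda>h. f z * E h + D h * g z)) (at z)"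
    by (rule has_derivative_mult[OF D(1) E(1)])
  with D(2) E(2) show ?thesis
    unfolding holo_at_def by (intro exI conjI) (auto simp: algebra_simps)
qed

lemma holo_at_cmult: "holo_at f z \<Longrightarrow> holo_at (\<lambda>z. c * f z) z"
  by (rule holo_at_mult[OF holo_at_const])

lemma holo_at_sum:
  "(\<And>i. i \<in> I \<Longrightarrow> holo_at (f i) z) \<Longrightarrow> holo_at (\<lambda>z. \<Sum>i\<in>I. f i z) z"
  by (induction I rule: infinite_finite_induct) (simp_all add: holo_at_const holo_at_add)

lemma holo_at_power: "holo_at f z \<Longrightarrow> holo_at (\<lambda>z. f z ^ n) z"
  by (induction n) (simp_all add: holo_at_const holo_at_mult)

lemma scaleC_scaleR_commute: "scaleC c (r *\<^sub>R x) = r *\<^sub>R scaleC c (x::'a::complex_normed_vector)"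
  by (simp add: scaleR_scaleC scaleC_scaleC mult.commute)

lemma holo_at_scaleR:
  assumes "holo_at f (r *\<^sub>R z)"
  shows "holo_at (\<lambda>w. f (r *\<^sub>R w)) z"
proof -
  have "((\<lambda>w. r *\<^sub>R w) has_derivative (\<lambda>h. r *\<^sub>R h)) (at z)"
    by (auto intro!: derivative_eq_intros)
  from has_derivative_compose[OF this holo_at_has_derivative[OF assms]]
  show ?thesis
    unfolding holo_at_def
    using holo_at_scaleC[OF assms] by (metis scaleC_scaleR_commute)
qed

lemma holo_at_frechet_derivative_scaleR:
  assumes "holo_at f z"
  shows "frechet_derivative f (at z) (r *\<^sub>R x) = r * frechet_derivative f (at z) x"
  using holo_at_scaleC[OF assms, of "of_real r" x] by (simp add: scaleC_of_real)

section \<open>Uniform bounds near compact sets\<close>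

lemma bounded_near_compact:
  fixes f :: "'a::metric_space \<Rightarrow> 'b::real_normed_vector"
  assumes "compact K" and cont: "\<And>x. x \<in> K \<Longrightarrow> isCont f x"
  obtains e M where "0 < e" "\<And>x y. x \<in> K \<Longrightarrow> y \<in> ball x e \<Longrightarrow> norm (f y) \<le> M"
proof (cases "K = {}")
  case True
  then show ?thesis using that[of 1] by simp
next
  case False
  have "\<exists>d>0. \<forall>y. dist y x < d \<longrightarrow> dist (f y) (f x) < 1" if "x \<in> K" for x
    using cont[OF that] unfolding continuous_at_eps_delta by (metis zero_less_one)
  then obtain d where d: "\<And>x. x \<in> K \<Longrightarrow> 0 < d x"
    "\<And>x y. x \<in> K \<Longrightarrow> dist y x < d x \<Longrightarrow> dist (f y) (f x) < 1" by metis
  obtain C where C: "C \<subseteq> K" "finite C" "K \<subseteq> (\<Union>x\<in>C. ball x (d x / 2))"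
    by (rule compactE_image[OF \<open>compact K\<close>, of K "\<lambda>x. ball x (d x / 2)"])
       (use d(1) in force)+
  have "C \<noteq> {}" using C False by blast
  \<comment> \<open>Points of \<open>K\<close> are covered by balls of half the radius
    \<open>d c\<close>, so a further move of less than half the smallest radius stays where
    \<open>f\<close> differs from \<open>f c\<close> by less than 1.\<close>
  define e where "e = Min (d ` C) / 2"
  have "0 < e" using C \<open>C \<noteq> {}\<close> d(1) by (auto simp: e_def)
  have e_le: "e \<le> d c / 2" if "c \<in> C" for c
    using C that by (simp add: e_def)
  show ?thesis
  proof (rule that[OF \<open>0 < e\<close>])
    fix x y assume "x \<in> K" "y \<in> ball x e"
    then obtain c where c: "c \<in> C" "dist c x < d c / 2" using C(3) by auto
    have "dist y c < d c"
      using c e_le[OF c(1)] \<open>y \<in> ball x e\<close> dist_triangle[of y c x]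
      by (simp add: dist_commute)
    then have "norm (f y) \<le> norm (f c) + 1"
      using d(2) c(1) C(1) norm_triangle_ineq2[of "f y" "f c"] by (fastforce simp: dist_norm)
    also have "\<dots> \<le> (\<Sum>c\<in>C. norm (f c)) + 1"
      using member_le_sum[OF c(1) _ C(2), of "\<lambda>c. norm (f c)"] by simp
    finally show "norm (f y) \<le> (\<Sum>c\<in>C. norm (f c)) + 1" .
  qed
qed

text \<open>The thickness is uniform along the whole segment, which is what allows one ball around
  \<open>z\<close> to serve for all \<open>t\<close>.\<close>

lemma bounded_near_segment:
  fixes f :: "'a::complex_normed_vector \<Rightarrow> complex"
  assumes f: "\<And>z. z \<in> ball 0 1 \<Longrightarrow> isCont f z" and z: "z \<in> ball 0 1"
  obtains e M where "0 < e" "\<And>t y. t \<in> {0..1} \<Longrightarrow> y \<in> ball (t *\<^sub>R z) e \<Longrightarrow> y \<in> ball 0 1 \<and> cmod (f y) \<le> M"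
proof -
  let ?K = "(\<lambda>t. t *\<^sub>R z) ` {0..1}"
  have "compact ?K"
    by (intro compact_continuous_image continuous_intros) auto
  moreover have K: "norm x \<le> norm z" if "x \<in> ?K" for x
    using that by (auto simp: mult_left_le_one_le)
  then have "isCont f x" if "x \<in> ?K" for x
    using that z f by fastforce
  ultimately obtain e M where e: "0 < e" "\<And>x y. x \<in> ?K \<Longrightarrow> y \<in> ball x e \<Longrightarrow> norm (f y) \<le> M"
    using bounded_near_compact by blast
  show ?thesis
  proof (rule that[of "min e (1 - norm z)" M])
    fix t :: real and y
    assume t: "t \<in> {0..1}" and y: "y \<in> ball (t *\<^sub>R z) (min e (1 - norm z))"
    have "norm y \<le> norm (t *\<^sub>R z) + dist (t *\<^sub>R z) y"
      using norm_triangle_ineq2[of y "t *\<^sub>R z"] by (simp add: dist_norm norm_minus_commute)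
    also have "\<dots> < norm z + (1 - norm z)"
      using y K[OF imageI[OF t]] by (intro add_le_less_mono) simp_all
    also have "\<dots> = 1" by simp
    finally show "y \<in> ball 0 1 \<and> cmod (f y) \<le> M"
      using e(2)[OF imageI[OF t], of y] y by simp
  qed (use e z in auto)
qed

text \<open>The function \<open>w \<mapsto> D\<phi>(t w) w\<close> is a bounded pointwise limit of the difference quotients
  \<open>n (\<phi>((t + 1/n) w) - \<phi>(t w))\<close>.\<close>

lemma holo_at_directional_derivative:
  fixes \<phi> :: "'a::complex_normed_vector \<Rightarrow> complex"
  assumes holo: "\<And>z. z \<in> ball 0 1 \<Longrightarrow> holo_at \<phi> z" and z: "z \<in> ball 0 1"
  obtains e B where "0 < e"
    "\<And>t w. t \<in> {0..1} \<Longrightarrow> w \<in> ball z e \<Longrightarrow>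
       holo_at (\<lambda>w. frechet_derivative \<phi> (at (t *\<^sub>R w)) w) w \<and>
       cmod (frechet_derivative \<phi> (at (t *\<^sub>R w)) w) \<le> B"
proof -
  obtain d M where d: "0 < d"
    "\<And>t y. t \<in> {0..1} \<Longrightarrow> y \<in> ball (t *\<^sub>R z) d \<Longrightarrow> y \<in> ball 0 1 \<and> cmod (\<phi> y) \<le> M"
    by (rule bounded_near_segment[OF holo_at_continuous[OF holo] z]) (assumption, rule that)
  \<comment> \<open>One half of \<open>d\<close> pays for moving from \<open>z\<close> to
    \<open>w\<close>, which the factor \<open>t\<close> does not enlarge; the other half leaves a
    ball around \<open>t *\<^sub>R w\<close> for the Cauchy estimates.\<close>
  define e where "e = d / 2"
  have "0 < e" using d by (simp add: e_def)
  let ?P = "\<lambda>t w. frechet_derivative \<phi> (at (t *\<^sub>R w)) w"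
  have ball: "y \<in> ball 0 1 \<and> cmod (\<phi> y) \<le> M"
    if "t \<in> {0..1}" "w \<in> ball z e" "y \<in> ball (t *\<^sub>R w) e" for t w y
  proof (rule d(2)[OF that(1)])
    have "dist (t *\<^sub>R z) (t *\<^sub>R w) \<le> dist z w"
      using that by (simp add: dist_norm scaleR_diff_right[symmetric] mult_left_le_one_le)
    then show "y \<in> ball (t *\<^sub>R z) d"
      using that dist_triangle[of "t *\<^sub>R z" y "t *\<^sub>R w"] by (simp add: e_def)
  qed
  have "cmod (\<phi> 0) \<le> M" using d(2)[of 0 0] d(1) by simp
  then have "0 \<le> M" using norm_ge_zero order_trans by blast
  have w1: "norm w < 1" if "w \<in> ball z e" for w
    using ball[OF _ that, of 1 w] \<open>0 < e\<close> by simp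
  have P_le: "cmod (?P t w) \<le> 2 * M / e" if "t \<in> {0..1}" "w \<in> ball z e" for t w
  proof -
    have "cmod (?P t w) \<le> 2 * M / e * norm w"
      using ball[OF that] \<open>0 < e\<close> by (intro frechet_derivative_le holo) auto
    also have "\<dots> \<le> 2 * M / e"
      using w1[OF that(2)] \<open>0 \<le> M\<close> \<open>0 < e\<close> by (intro mult_right_le_one_le) auto
    finally show ?thesis .
  qed
  define q where "q t n w = of_nat n * (\<phi> ((t + 1 / real n) *\<^sub>R w) - \<phi> (t *\<^sub>R w))" for t n w
  define C where "C = 32 * M / e\<^sup>2"
  have "0 \<le> C" using \<open>0 \<le> M\<close> by (simp add: C_def)
  \<comment> \<open>The lower bound on \<open>n\<close> makes the increment at most
    \<open>e / 2\<close>, as the remainder estimate asks. For \<open>t = 1\<close> the point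
    \<open>(t + 1 / real n) *\<^sub>R w\<close> lies beyond the end of the segment, but still in the
    ball of radius \<open>e\<close> around \<open>w\<close>.\<close>
  have q: "holo_at (q t n) w \<and> cmod (q t n w - ?P t w) \<le> C / real n"
    if "t \<in> {0..1}" "w \<in> ball z e" "2 / e \<le> real n" for t n w
  proof -
    have n: "0 < real n" using that(3) \<open>0 < e\<close> by (smt (verit) divide_pos_pos)
    define h where "h = (1 / real n) *\<^sub>R w"
    have h: "norm h \<le> e / 2" "norm h \<le> 1 / real n"
      using that(3) n w1[OF that(2)] \<open>0 < e\<close>
      by (auto simp: h_def field_simps intro: order_trans mult_left_mono)
    have eq: "(t + 1 / real n) *\<^sub>R w = t *\<^sub>R w + h" by (simp add: h_def scaleR_add_left)
    have "t *\<^sub>R w + h \<in> ball (t *\<^sub>R w) e" "t *\<^sub>R w \<in> ball (t *\<^sub>R w) e"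
      using h \<open>0 < e\<close> by (simp_all add: dist_norm)
    then have "holo_at \<phi> ((t + 1 / real n) *\<^sub>R w)" "holo_at \<phi> (t *\<^sub>R w)"
      unfolding eq using ball[OF that(1,2)] holo by blast+
    then have "holo_at (q t n) w"
      unfolding q_def by (intro holo_at_cmult holo_at_diff holo_at_scaleR)
    have "cmod (\<phi> (t *\<^sub>R w + h) - \<phi> (t *\<^sub>R w) - frechet_derivative \<phi> (at (t *\<^sub>R w)) h)
        \<le> 32 * M * (norm h / e)\<^sup>2"
      using ball[OF that(1,2)] h \<open>0 < e\<close> by (intro frechet_derivative_remainder_le holo) auto
    also have "\<dots> \<le> 32 * M * ((1 / real n) / e)\<^sup>2"
      using h \<open>0 < e\<close> \<open>0 \<le> M\<close> by (intro mult_left_mono power_mono divide_right_mono) auto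
    finally have "real n * cmod (\<phi> (t *\<^sub>R w + h) - \<phi> (t *\<^sub>R w) - frechet_derivative \<phi> (at (t *\<^sub>R w)) h)
        \<le> real n * (32 * M * ((1 / real n) / e)\<^sup>2)"
      using n by (intro mult_left_mono) auto
    also have "\<dots> = C / real n"
      using n by (simp add: C_def power2_eq_square)
    finally have *: "cmod (of_nat n * (\<phi> (t *\<^sub>R w + h) - \<phi> (t *\<^sub>R w) - frechet_derivative \<phi> (at (t *\<^sub>R w)) h))
        \<le> C / real n"
      by (simp add: norm_mult)
    have "of_nat n * frechet_derivative \<phi> (at (t *\<^sub>R w)) h = ?P t w"
      using holo_at_frechet_derivative_scaleR[OF \<open>holo_at \<phi> (t *\<^sub>R w)\<close>, of "1 / real n" w] n
      by (simp add: h_def)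
    then have "of_nat n * (\<phi> (t *\<^sub>R w + h) - \<phi> (t *\<^sub>R w) - frechet_derivative \<phi> (at (t *\<^sub>R w)) h)
        = q t n w - ?P t w"
      unfolding q_def eq by (simp add: right_diff_distrib)
    with * \<open>holo_at (q t n) w\<close> show ?thesis by simp
  qed
  show ?thesis
  proof (rule that[OF \<open>0 < e\<close>], intro conjI)
    fix t :: real and w assume t: "t \<in> {0..1}" and w: "w \<in> ball z e"
    show "cmod (?P t w) \<le> 2 * M / e" by (rule P_le[OF t w])
    define R where "R = e - dist z w"
    have "0 < R" using w by (simp add: R_def)
    have R: "v \<in> ball z e" if "v \<in> ball w R" for v
      using that dist_triangle[of z v w] by (simp add: R_def)
    have ev: "\<forall>\<^sub>F n in sequentially. 2 / e \<le> real n"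
      using eventually_ge_at_top[of "nat \<lceil>2 / e\<rceil>"] by eventually_elim linarith
    show "holo_at (?P t) w"
    proof (rule holo_at_bounded_pointwise_limit[OF _ \<open>0 < R\<close>, where F = sequentially and g = "q t"
          and M = "2 * M / e + C"])
      show "\<forall>\<^sub>F n in sequentially. \<forall>w\<in>ball w R. holo_at (q t n) w \<and> cmod (q t n w) \<le> 2 * M / e + C"
        using ev eventually_ge_at_top[of 1]
      proof eventually_elim
        case (elim n)
        show ?case
        proof (intro ballI conjI)
          fix v assume v: "v \<in> ball w R"
          have "C / real n \<le> C / 1"
            using \<open>0 \<le> C\<close> elim(2) by (intro divide_left_mono) auto
          then show "cmod (q t n v) \<le> 2 * M / e + C"
            using q[OF t R[OF v] elim(1)] P_le[OF t R[OF v]]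
              norm_triangle_ineq[of "q t n v - ?P t v" "?P t v"] by simp
        qed (use q[OF t R elim(1)] in blast)
      qed
      show "(\<lambda>n. q t n v) \<longlonglongrightarrow> ?P t v" if "v \<in> ball w R" for v
      proof (rule LIM_zero_cancel, rule Lim_null_comparison)
        show "\<forall>\<^sub>F n in sequentially. cmod (q t n v - ?P t v) \<le> C / real n"
          using ev by eventually_elim (use q[OF t R[OF that]] in blast)
        show "(\<lambda>n. C / real n) \<longlonglongrightarrow> 0" by (rule lim_const_over_n)
      qed
    qed simp
  qed
qed

section \<open>The extended Cesaro operator\<close>

text \<open>The integrand of \<open>cesaro_op\<close> with \<open>1 / t\<close> cancelled. The two
  differ at most at \<open>t = 0\<close>, where \<open>1 / 0 = 0\<close> makes the original vanish
  while the kernel has its continuous value.\<close>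

definition cesaro_kernel ::
  "('a::complex_normed_vector \<Rightarrow> complex) \<Rightarrow> ('a \<Rightarrow> complex) \<Rightarrow> 'a \<Rightarrow> real \<Rightarrow> complex" where
  "cesaro_kernel \<phi> f z t = f (t *\<^sub>R z) * frechet_derivative \<phi> (at (t *\<^sub>R z)) z"

lemma scaleR_in_unit_ball:
  "z \<in> ball 0 1 \<Longrightarrow> 0 \<le> t \<Longrightarrow> t \<le> 1 \<Longrightarrow> t *\<^sub>R z \<in> ball (0::'a::real_normed_vector) 1"
  using mult_left_le_one_le[of "norm z" t] by auto

text \<open>\<open>holo_at\<close> does not itself assert continuity of the derivative. Along the
  ray it is the derivative of the one-variable function \<zeta> \<mapsto>
  \<open>\<phi> (scaleC \<zeta> z)\<close>, which is holomorphic and therefore continuous.\<close>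

lemma continuous_cesaro_kernel:
  assumes f: "f \<in> holo_ball" and \<phi>: "\<phi> \<in> holo_ball" and z: "z \<in> ball 0 1"
  shows "continuous_on {0..1} (cesaro_kernel \<phi> f z)"
proof -
  \<comment> \<open>A radius larger than 1, so that the endpoint \<open>t = 1\<close> is interior to
    the disc, with \<open>norm z * r\<close> still at most 1.\<close>
  define r where "r = 2 / (1 + norm z)"
  have r: "1 < r" "norm z * r \<le> 1" using z by (auto simp: r_def field_simps add_pos_nonneg)
  have holo: "\<And>z. z \<in> ball 0 1 \<Longrightarrow> holo_at \<phi> z" using \<phi> by (simp add: holo_ball_iff)
  have "(\<lambda>\<zeta>. \<phi> (0 + scaleC \<zeta> z)) holomorphic_on ball 0 r"
    by (rule holomorphic_on_line[OF holo _ r(2)]) auto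
  then have "continuous_on (ball 0 r) (deriv (\<lambda>\<zeta>. \<phi> (scaleC \<zeta> z)))"
    using holomorphic_deriv holomorphic_on_imp_continuous_on by fastforce
  then have "continuous_on {0..1} (\<lambda>t. deriv (\<lambda>\<zeta>. \<phi> (scaleC \<zeta> z)) (complex_of_real t))"
    by (rule continuous_on_compose2) (use r in \<open>auto intro!: continuous_intros\<close>)
  moreover have "deriv (\<lambda>\<zeta>. \<phi> (scaleC \<zeta> z)) (complex_of_real t) = frechet_derivative \<phi> (at (t *\<^sub>R z)) z"
    if "t \<in> {0..1}" for t
    using holo_at_line_derivative[of \<phi> 0 "of_real t" z] holo[OF scaleR_in_unit_ball[OF z]] that
    by (intro DERIV_imp_deriv) (simp add: scaleC_of_real)
  ultimately have "continuous_on {0..1} (\<lambda>t. frechet_derivative \<phi> (at (t *\<^sub>R z)) z)"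
    by (rule continuous_on_eq)
  moreover have "continuous_on (ball 0 1) f"
    using f holo_at_continuous by (intro continuous_at_imp_continuous_on) (auto simp: holo_ball_iff)
  then have "continuous_on {0..1} (\<lambda>t. f (t *\<^sub>R z))"
    by (rule continuous_on_compose2)
       (use scaleR_in_unit_ball[OF z] in \<open>auto intro!: continuous_intros\<close>)
  ultimately show ?thesis
    unfolding cesaro_kernel_def by (intro continuous_on_mult)
qed

lemma cesaro_op_eq:
  assumes \<phi>: "\<phi> \<in> holo_ball" and z: "z \<in> ball 0 1"
  shows "cesaro_op \<phi> f z = integral {0..1} (cesaro_kernel \<phi> f z)"
proof -
  have "f (t *\<^sub>R z) * radial_deriv \<phi> (t *\<^sub>R z) * complex_of_real (1 / t) = cesaro_kernel \<phi> f z t"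
    if "t \<in> {0..1} - {0}" for t
  proof -
    have "holo_at \<phi> (t *\<^sub>R z)" using \<phi> that scaleR_in_unit_ball[OF z] by (auto simp: holo_ball_iff)
    then show ?thesis
      using that by (simp add: radial_deriv_def cesaro_kernel_def holo_at_frechet_derivative_scaleR)
  qed
  then have "integral {0..1} (\<lambda>t. f (t *\<^sub>R z) * radial_deriv \<phi> (t *\<^sub>R z) * complex_of_real (1 / t))
      = integral {0..1} (cesaro_kernel \<phi> f z)"
    by (intro integral_spike[of "{0}"]) auto
  with z show ?thesis by (simp add: cesaro_op_def)
qed

lemma cesaro_op_holo_ball:
  assumes f: "f \<in> holo_ball" and \<phi>: "\<phi> \<in> holo_ball"
  shows "cesaro_op \<phi> f \<in> holo_ball"
  unfolding holo_ball_iff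
proof (intro conjI ballI allI impI)
  fix z :: 'a assume z: "z \<in> ball 0 1"
  have f': "\<And>z. z \<in> ball 0 1 \<Longrightarrow> holo_at f z" and \<phi>': "\<And>z. z \<in> ball 0 1 \<Longrightarrow> holo_at \<phi> z"
    using f \<phi> by (auto simp: holo_ball_iff)
  obtain d M where d: "0 < d"
    "\<And>t y. t \<in> {0..1} \<Longrightarrow> y \<in> ball (t *\<^sub>R z) d \<Longrightarrow> y \<in> ball 0 1 \<and> cmod (f y) \<le> M"
    by (rule bounded_near_segment[OF holo_at_continuous[OF f'] z]) (assumption, rule that)
  let ?P = "\<lambda>t w. frechet_derivative \<phi> (at (t *\<^sub>R w)) w"
  obtain e B where e: "0 < e"
    "\<And>t w. t \<in> {0..1} \<Longrightarrow> w \<in> ball z e \<Longrightarrow> holo_at (?P t) w \<and> cmod (?P t w) \<le> B"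
    by (rule holo_at_directional_derivative[OF \<phi>' z]) (assumption, rule that)
  define R where "R = min d e"
  have "0 < R" using d e by (simp add: R_def)
  let ?H = "cesaro_kernel \<phi> f"
  have H: "w \<in> ball 0 1 \<and> holo_at (\<lambda>w. ?H w t) w \<and> cmod (?H w t) \<le> M * B"
    if t: "t \<in> {0..1}" and w: "w \<in> ball z R" for t w
  proof -
    have "dist (t *\<^sub>R z) (t *\<^sub>R w) \<le> dist z w"
      using t by (simp add: dist_norm scaleR_diff_right[symmetric] mult_left_le_one_le)
    then have 1: "t *\<^sub>R w \<in> ball 0 1 \<and> cmod (f (t *\<^sub>R w)) \<le> M"
      using t w by (intro d(2)) (auto simp: R_def)
    have 2: "holo_at (?P t) w \<and> cmod (?P t w) \<le> B" using t w by (intro e(2)) (auto simp: R_def)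
    have "w \<in> ball 0 1" using d(2)[of 1 w] w by (auto simp: R_def)
    moreover have "holo_at (\<lambda>w. ?H w t) w"
      unfolding cesaro_kernel_def using 1 2 by (intro holo_at_mult holo_at_scaleR f') auto
    moreover have "cmod (?H w t) \<le> M * B"
      unfolding cesaro_kernel_def norm_mult using 1 2
      by (intro mult_mono) (auto intro: order_trans[OF norm_ge_zero])
    ultimately show ?thesis by blast
  qed
  \<comment> \<open>Riemann sums of the gauge integral, indexed by tagged divisions and converging
    along \<open>division_filter\<close>. Their weights are nonnegative with total 1, so they
    inherit the bound \<open>M * B\<close> of the kernel.\<close>
  define g where "g p w = (\<Sum>(x,k)\<in>p. measure lborel k *\<^sub>R ?H w x)" for p :: "(real \<times> real set) set" and w
  have "holo_at (\<lambda>w. integral {0..1} (?H w)) z"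
  proof (rule holo_at_bounded_pointwise_limit[OF _ \<open>0 < R\<close>,
        where F = "division_filter (cbox 0 1)" and g = g and M = "M * B"])
    show "\<forall>\<^sub>F p in division_filter (cbox 0 1). \<forall>w\<in>ball z R. holo_at (g p) w \<and> cmod (g p w) \<le> M * B"
      using eventually_division_filter_tagged_division
    proof eventually_elim
      case (elim p)
      have tag: "x \<in> {0..1}" if "(x, k) \<in> p" for x k
        using tag_in_interval[OF elim that] by simp
      show ?case
      proof (intro ballI conjI)
        fix w assume w: "w \<in> ball z R"
        show "holo_at (g p) w"
          unfolding g_def split_def scaleR_conv_of_real
          using H[OF tag w] by (intro holo_at_sum holo_at_cmult) auto
        have "cmod (g p w) \<le> (\<Sum>x\<in>p. cmod (measure lborel (snd x) *\<^sub>R ?H w (fst x)))"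
          unfolding g_def split_def by (rule norm_sum)
        also have "\<dots> \<le> (\<Sum>x\<in>p. measure lborel (snd x) * (M * B))"
          using H[OF tag w] by (intro sum_mono) (auto intro!: mult_left_mono)
        also have "\<dots> = M * B"
          using additive_content_tagged_division[OF elim]
          by (simp add: sum_distrib_right[symmetric] split_def)
        finally show "cmod (g p w) \<le> M * B" .
      qed
    qed
    show "((\<lambda>p. g p w) \<longlongrightarrow> integral {0..1} (?H w)) (division_filter (cbox 0 1))"
      if "w \<in> ball z R" for w
    proof -
      have "?H w integrable_on cbox 0 1"
        using continuous_cesaro_kernel[OF f \<phi>] H[of 0 w] that
        by (intro integrable_continuous) auto
      then show ?thesis
        unfolding g_def using has_integral_cbox[of "?H w"] integrable_integral by force
    qed
  qed (rule division_filter_not_empty)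
  then show "holo_at (cesaro_op \<phi> f) z"
    by (rule holo_at_transform[of _ _ "ball 0 1"]) (use z in \<open>simp_all add: cesaro_op_eq[OF \<phi>]\<close>)
qed (simp add: cesaro_op_def)

text \<open>Substitution turns the operator at \<open>s *\<^sub>R z\<close> into the integral of one
  fixed kernel over \<open>{0..s}\<close>. Its derivative at \<open>s = 1\<close> is computed by the
  chain rule and by the fundamental theorem of calculus; both are taken within
  \<open>{0..1}\<close>, where a one-sided derivative at the endpoint is still unique.\<close>

lemma radial_deriv_cesaro_op:
  assumes f: "f \<in> holo_ball" and \<phi>: "\<phi> \<in> holo_ball" and z: "z \<in> ball 0 1"
  shows "radial_deriv (cesaro_op \<phi> f) z = f z * radial_deriv \<phi> z"
proof -
  let ?K = "cesaro_kernel \<phi> f z" and ?T = "cesaro_op \<phi> f"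
  have T: "?T (s *\<^sub>R z) = integral {0..s} ?K" if s: "s \<in> {0..1}" for s
  proof -
    have "cesaro_kernel \<phi> f (s *\<^sub>R z) t = s * ?K (s * t)" if "t \<in> {0..1}" for t
    proof -
      have "holo_at \<phi> ((s * t) *\<^sub>R z)"
        using \<phi> s that by (auto simp: holo_ball_iff mult_le_one simp del: mem_ball intro!: scaleR_in_unit_ball[OF z])
      then show ?thesis
        by (simp add: cesaro_kernel_def holo_at_frechet_derivative_scaleR mult.commute[of t s])
    qed
    then have "integral {0..1} (cesaro_kernel \<phi> f (s *\<^sub>R z)) = integral {0..1} (\<lambda>t. s * ?K (s * t))"
      by (rule Henstock_Kurzweil_Integration.integral_cong)
    then have eq: "?T (s *\<^sub>R z) = s * integral {0..1} (\<lambda>t. ?K (s * t))"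
      using cesaro_op_eq[OF \<phi> scaleR_in_unit_ball[OF z], of s f] s by simp
    show ?thesis
    proof (cases "s = 0")
      case False
      then have "(\<lambda>x. x / s) ` {0..s} = {0..1}"
        using s image_divide_atLeastAtMost[of s 0 s] by simp
      then show ?thesis
        using integral_stretch_real[OF False, of 0 s ?K] False s eq
        by (simp add: scaleR_conv_of_real)
    qed (use eq in simp)
  qed
  have "holo_at ?T z" using cesaro_op_holo_ball[OF f \<phi>] z by (simp add: holo_ball_iff)
  then have hd: "(?T has_derivative frechet_derivative ?T (at z)) (at (1 *\<^sub>R z))"
    using holo_at_has_derivative by force
  have "((\<lambda>s. s *\<^sub>R z) has_derivative (\<lambda>s. s *\<^sub>R z)) (at 1 within {0..1})"
    by (auto intro!: derivative_eq_intros)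
  from has_derivative_compose[OF this hd]
  have "((\<lambda>s. ?T (s *\<^sub>R z)) has_vector_derivative frechet_derivative ?T (at z) z) (at 1 within {0..1})"
    using holo_at_frechet_derivative_scaleR[OF \<open>holo_at ?T z\<close>]
    by (simp add: has_vector_derivative_def scaleR_conv_of_real)
  moreover have "((\<lambda>s. integral {0..s} ?K) has_vector_derivative ?K 1) (at 1 within {0..1})"
    by (rule integral_has_vector_derivative[OF continuous_cesaro_kernel[OF f \<phi> z]]) simp
  then have "((\<lambda>s. ?T (s *\<^sub>R z)) has_vector_derivative ?K 1) (at 1 within {0..1})"
    by (rule has_vector_derivative_transform[rotated 2]) (auto simp: T)
  ultimately have "frechet_derivative ?T (at z) z = ?K 1"
    using vector_derivative_unique_within_closed_interval[of 0 1 1] by fastforce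
  then show ?thesis by (simp add: radial_deriv_def cesaro_kernel_def)
qed

text \<open>Hence the point evaluation in the Bloch norm drops out for every image of the
  operator.\<close>

lemma cesaro_op_0:
  assumes "\<phi> \<in> holo_ball"
  shows "cesaro_op \<phi> f 0 = 0"
proof -
  have "holo_at \<phi> 0" using assms by (simp add: holo_ball_iff)
  then have "frechet_derivative \<phi> (at 0) 0 = 0"
    by (rule linear_0[OF holo_at_linear])
  then show ?thesis by (simp add: cesaro_op_def radial_deriv_def)
qed

lemma cesaro_op_add:
  assumes f: "f \<in> holo_ball" and g: "g \<in> holo_ball" and \<phi>: "\<phi> \<in> holo_ball"
  shows "cesaro_op \<phi> (\<lambda>z. f z + g z) = (\<lambda>z. cesaro_op \<phi> f z + cesaro_op \<phi> g z)"
proof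
  fix z
  show "cesaro_op \<phi> (\<lambda>z. f z + g z) z = cesaro_op \<phi> f z + cesaro_op \<phi> g z"
  proof (cases "z \<in> ball 0 1")
    case True
    have "cesaro_kernel \<phi> (\<lambda>z. f z + g z) z = (\<lambda>t. cesaro_kernel \<phi> f z t + cesaro_kernel \<phi> g z t)"
      by (simp add: cesaro_kernel_def distrib_right fun_eq_iff)
    then show ?thesis
      using True f g
      by (simp add: cesaro_op_eq[OF \<phi>] Henstock_Kurzweil_Integration.integral_add
          integrable_continuous_real continuous_cesaro_kernel[OF _ \<phi>] del: mem_ball)
  qed (simp add: cesaro_op_def)
qed

lemma cesaro_op_cmult:
  assumes "\<phi> \<in> holo_ball"
  shows "cesaro_op \<phi> (\<lambda>z. c * f z) = (\<lambda>z. c * cesaro_op \<phi> f z)"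
proof
  fix z
  show "cesaro_op \<phi> (\<lambda>z. c * f z) z = c * cesaro_op \<phi> f z"
  proof (cases "z \<in> ball 0 1")
    case True
    have "cesaro_kernel \<phi> (\<lambda>z. c * f z) z = (\<lambda>t. c * cesaro_kernel \<phi> f z t)"
      by (simp add: cesaro_kernel_def fun_eq_iff)
    then show ?thesis
      using True by (simp add: cesaro_op_eq[OF assms] Henstock_Kurzweil_Integration.integral_mult_right del: mem_ball)
  qed (simp add: cesaro_op_def)
qed

section \<open>Growth of Bloch-type functions\<close>

lemma radial_deriv_scaleC:
  assumes "holo_at f (scaleC c u)"
  shows "radial_deriv f (scaleC c u) = c * frechet_derivative f (at (scaleC c u)) u"
  by (simp add: radial_deriv_def holo_at_scaleC[OF assms])

lemma radial_deriv_scaleR: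
  assumes "holo_at f (x *\<^sub>R u)"
  shows "radial_deriv f (x *\<^sub>R u) = x * frechet_derivative f (at (x *\<^sub>R u)) u"
  using radial_deriv_scaleC[of f "of_real x" u] assms by (simp add: scaleC_of_real)

lemma exists_unit_direction:
  fixes z :: "'a::real_normed_vector"
  assumes "z \<noteq> 0"
  obtains u where "norm u = 1" "z = norm z *\<^sub>R u"
  using assms that[of "sgn z"] by (simp add: norm_sgn sgn_div_norm)

text \<open>On the circle of radius \<open>r\<close> the radial derivative is \<zeta> times the
  derivative in direction \<open>u\<close>, so \<open>A\<close> becomes \<open>A / r\<close> there.
  The maximum principle carries this inwards to 0, where dividing by the modulus of \<zeta> would
  fail.\<close>

lemma frechet_derivative_le_radial_deriv:
  fixes f :: "'a::complex_normed_vector \<Rightarrow> complex"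
  assumes f: "f \<in> holo_ball" and r: "0 < r" "r < 1" and u: "norm u = 1"
    and A: "\<And>y. norm y = r \<Longrightarrow> cmod (radial_deriv f y) \<le> A" and x: "0 \<le> x" "x \<le> r"
  shows "cmod (frechet_derivative f (at (x *\<^sub>R u)) u) \<le> A / r"
proof -
  have holo: "\<And>z. z \<in> ball 0 1 \<Longrightarrow> holo_at f z" using f by (simp add: holo_ball_iff)
  let ?k = "\<lambda>\<zeta>. f (scaleC \<zeta> u)"
  have "?k holomorphic_on ball 0 1"
    using holomorphic_on_line[of 0 1 f u 1, OF holo] u by simp
  then have hol: "deriv ?k holomorphic_on ball 0 1"
    by (rule holomorphic_deriv) simp
  have deriv: "deriv ?k \<zeta> = frechet_derivative f (at (scaleC \<zeta> u)) u" if "cmod \<zeta> < 1" for \<zeta>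
    using holo_at_line_derivative[of f 0 \<zeta> u] holo[of "scaleC \<zeta> u"] that u
    by (intro DERIV_imp_deriv) (simp add: norm_scaleC)
  have "cmod (deriv ?k (of_real x)) \<le> A / r"
  proof (rule maximum_modulus_frontier[where f = "deriv ?k" and S = "cball 0 r"])
    show "deriv ?k holomorphic_on interior (cball 0 r)"
      using hol by (rule holomorphic_on_subset) (use r in auto)
    show "continuous_on (closure (cball 0 r)) (deriv ?k)"
      using hol[THEN holomorphic_on_imp_continuous_on]
      by (rule continuous_on_subset) (use r in auto)
    show "cmod (deriv ?k \<zeta>) \<le> A / r" if "\<zeta> \<in> frontier (cball 0 r)" for \<zeta>
    proof -
      have \<zeta>: "cmod \<zeta> = r" using that r by simp
      have "holo_at f (scaleC \<zeta> u)" using \<zeta> u r by (intro holo) (simp add: norm_scaleC)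
      then show ?thesis
        using A[of "scaleC \<zeta> u"] \<zeta> u r
        by (simp add: radial_deriv_scaleC deriv norm_scaleC norm_mult field_simps)
    qed
  qed (use r x in auto)
  then show ?thesis using deriv[of "of_real x"] r x by (simp add: scaleC_of_real)
qed

text \<open>Mean value inequality with \<open>c\<close> times the integral of
  \<open>1 / \<omega>\<close> as majorant. The lower end \<open>r\<close> is free, so that a small
  \<open>c\<close> valid only near the sphere can be used.\<close>

lemma ray_growth:
  fixes f :: "'a::complex_normed_vector \<Rightarrow> complex"
  assumes f: "f \<in> holo_ball" and cont: "continuous_on {0..<1} \<omega>" and pos: "\<forall>r\<in>{0..<1}. 0 < \<omega> r"
    and rs: "0 \<le> r" "r \<le> s" "s < 1" and u: "norm u = 1"
    and bnd: "\<And>x. r < x \<Longrightarrow> x < s \<Longrightarrow> cmod (frechet_derivative f (at (x *\<^sub>R u)) u) \<le> c / \<omega> x"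
  shows "cmod (f (s *\<^sub>R u) - f (r *\<^sub>R u))
           \<le> c * integral {0..s} (\<lambda>t. 1 / \<omega> t) - c * integral {0..r} (\<lambda>t. 1 / \<omega> t)"
proof (cases "r = s")
  case False
  let ?I = "\<lambda>x. integral {0..x} (\<lambda>t. 1 / \<omega> t)"
  have holo: "holo_at f (x *\<^sub>R u)" if "x \<in> {r..s}" for x
    using f rs that u by (auto simp: holo_ball_iff)
  have der: "((\<lambda>x. f (x *\<^sub>R u)) has_vector_derivative frechet_derivative f (at (x *\<^sub>R u)) u) (at x)"
    if "x \<in> {r..s}" for x
  proof -
    have "((\<lambda>x. x *\<^sub>R u) has_derivative (\<lambda>x. x *\<^sub>R u)) (at x)"
      by (auto intro!: derivative_eq_intros)
    from has_derivative_compose[OF this holo_at_has_derivative[OF holo[OF that]]] show ?thesis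
      using holo_at_linear[OF holo[OF that]] by (simp add: has_vector_derivative_def linear_scale)
  qed
  have "continuous_on {0..s} (\<lambda>t. 1 / \<omega> t)"
    using rs pos by (intro continuous_intros continuous_on_subset[OF cont]) force+
  then have I: "(?I has_vector_derivative 1 / \<omega> x) (at x within {0..s})" if "x \<in> {0..s}" for x
    using integral_has_vector_derivative that by blast
  show ?thesis
  proof (rule differentiable_bound_general[where f = "\<lambda>x. f (x *\<^sub>R u)" and \<phi> = "\<lambda>x. c * ?I x"
        and \<phi>' = "\<lambda>x. c * (1 / \<omega> x)"])
    show "r < s" using False rs by simp
    show "continuous_on {r..s} (\<lambda>x. f (x *\<^sub>R u))"
      using der by (intro continuous_at_imp_continuous_on ballI) (rule has_vector_derivative_continuous)
    have "continuous_on {0..s} ?I"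
      by (rule continuous_on_vector_derivative) (rule I)
    then show "continuous_on {r..s} (\<lambda>x. c * ?I x)"
      using rs by (intro continuous_intros) (auto elim: continuous_on_subset)
    show "((\<lambda>x. c * ?I x) has_vector_derivative c * (1 / \<omega> x)) (at x)" if "r < x" "x < s" for x
      using I[of x] that rs by (intro has_vector_derivative_mult_right) (simp add: at_within_Icc_at)
    show "((\<lambda>x. f (x *\<^sub>R u)) has_vector_derivative frechet_derivative f (at (x *\<^sub>R u)) u) (at x)"
      if "r < x" "x < s" for x
      using that by (intro der) simp
    show "cmod (frechet_derivative f (at (x *\<^sub>R u)) u) \<le> c * (1 / \<omega> x)" if "r < x" "x < s" for x
      using bnd[OF that] by simp
  qed
qed simp

lemma bounded_on_subinterval:
  assumes cont: "continuous_on {0..<1} (\<omega> :: real \<Rightarrow> real)" and "r < 1"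
  obtains m where "\<And>x. 0 \<le> x \<Longrightarrow> x \<le> r \<Longrightarrow> \<omega> x \<le> m"
proof -
  have "compact (\<omega> ` {0..r})"
    using \<open>r < 1\<close> by (intro compact_continuous_image continuous_on_subset[OF cont]) auto
  then have "bdd_above (\<omega> ` {0..r})" by (intro bounded_imp_bdd_above compact_imp_bounded)
  then show ?thesis using that unfolding bdd_above_def by fastforce
qed

text \<open>On \<open>[0, 1/2]\<close> the radial derivative bound is divided by a vanishing factor; there the
  maximum principle on the circle of radius \<open>1/2\<close> is used instead.\<close>

lemma frechet_derivative_bloch_bound:
  fixes \<omega> :: "real \<Rightarrow> real"
  assumes cont: "continuous_on {0..<1} \<omega>" and pos: "\<forall>r\<in>{0..<1}. 0 < \<omega> r"
  obtains C where "0 \<le> C"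
    "\<And>(f :: 'a::complex_normed_vector \<Rightarrow> complex) B (x::real) (u::'a). f \<in> holo_ball \<Longrightarrow>
       (\<forall>y\<in>ball 0 1. \<omega> (norm y) * cmod (radial_deriv f y) \<le> B) \<Longrightarrow>
       norm u = 1 \<Longrightarrow> 0 \<le> x \<Longrightarrow> x < 1 \<Longrightarrow>
       cmod (frechet_derivative f (at (x *\<^sub>R u)) u) \<le> C * B / \<omega> x"
proof -
  obtain m where m: "\<And>x. 0 \<le> x \<Longrightarrow> x \<le> 1/2 \<Longrightarrow> \<omega> x \<le> m"
    using bounded_on_subinterval[OF cont, of "1/2"] by auto
  have half: "0 < \<omega> (1/2)" "\<omega> (1/2) \<le> m" using pos m by auto
  \<comment> \<open>On \<open>{0..1/2}\<close> replacing \<open>1 / \<omega> (1/2)\<close> by a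
    multiple of \<open>1 / \<omega> x\<close> costs \<open>m / \<omega> (1/2)\<close>. As this is at
    least 1, \<open>C\<close> also covers the factor 2 lost when dividing by
    \<open>x > 1/2\<close>.\<close>
  define C where "C = 2 * m / \<omega> (1/2)"
  have "2 \<le> C" using half by (simp add: C_def field_simps)
  show ?thesis
  proof (rule that[of C])
    fix f :: "'a \<Rightarrow> complex" and B x :: real and u :: 'a
    assume f: "f \<in> holo_ball" and B: "\<forall>y\<in>ball 0 1. \<omega> (norm y) * cmod (radial_deriv f y) \<le> B"
      and u: "norm u = 1" and x: "0 \<le> x" "x < 1"
    have "0 \<le> \<omega> 0 * cmod (radial_deriv f 0)" using pos by (simp add: less_imp_le)
    also have "\<dots> \<le> B" using bspec[OF B, of 0] by simp
    finally have "0 \<le> B" .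
    have wx: "0 < \<omega> x" using pos x by simp
    show "cmod (frechet_derivative f (at (x *\<^sub>R u)) u) \<le> C * B / \<omega> x"
    proof (cases "x \<le> 1/2")
      case True
      have "cmod (frechet_derivative f (at (x *\<^sub>R u)) u) \<le> (B / \<omega> (1/2)) / (1/2)"
      proof (rule frechet_derivative_le_radial_deriv[OF f _ _ u])
        show "cmod (radial_deriv f y) \<le> B / \<omega> (1/2)" if "norm y = 1/2" for y
          using bspec[OF B, of y] that half by (simp add: field_simps)
      qed (use x True in auto)
      also have "\<dots> = 2 * B / \<omega> (1/2) * (\<omega> x / \<omega> x)" using wx by simp
      also have "\<dots> \<le> 2 * B / \<omega> (1/2) * (m / \<omega> x)"
        using m[OF x(1) True] wx half \<open>0 \<le> B\<close> by (intro mult_left_mono divide_right_mono) auto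
      finally show ?thesis by (simp add: C_def mult_ac)
    next
      case False
      have xu: "x *\<^sub>R u \<in> ball 0 1" using x u by simp
      then have "holo_at f (x *\<^sub>R u)" using f unfolding holo_ball_iff by blast
      then have "\<omega> x * (x * cmod (frechet_derivative f (at (x *\<^sub>R u)) u)) \<le> B"
        using bspec[OF B xu] x u by (simp add: radial_deriv_scaleR norm_mult)
      moreover have "\<omega> x * (1/2 * cmod (frechet_derivative f (at (x *\<^sub>R u)) u))
          \<le> \<omega> x * (x * cmod (frechet_derivative f (at (x *\<^sub>R u)) u))"
        using False wx by (intro mult_left_mono mult_right_mono) auto
      ultimately have "\<omega> x * (1/2 * cmod (frechet_derivative f (at (x *\<^sub>R u)) u)) \<le> B"
        by linarith
      then have "cmod (frechet_derivative f (at (x *\<^sub>R u)) u) \<le> 2 * B / \<omega> x"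
        using wx by (simp add: field_simps)
      also have "\<dots> \<le> C * B / \<omega> x"
        using \<open>2 \<le> C\<close> \<open>0 \<le> B\<close> wx by (intro divide_right_mono mult_right_mono) auto
      finally show ?thesis .
    qed
  qed (use \<open>2 \<le> C\<close> in simp)
qed

text \<open>\<open>C\<close> is obtained before \<open>f\<close>, \<open>B\<close> and
  \<open>z\<close>, so it can enter an operator norm.\<close>

lemma bloch_growth:
  fixes \<omega> :: "real \<Rightarrow> real"
  assumes cont: "continuous_on {0..<1} \<omega>" and pos: "\<forall>r\<in>{0..<1}. 0 < \<omega> r"
  obtains C where "0 \<le> C"
    "\<And>(f :: 'a::complex_normed_vector \<Rightarrow> complex) B (z::'a). f \<in> holo_ball \<Longrightarrow>
       (\<forall>y\<in>ball 0 1. \<omega> (norm y) * cmod (radial_deriv f y) \<le> B) \<Longrightarrow>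
       z \<in> ball 0 1 \<Longrightarrow> cmod (f z) \<le> cmod (f 0) + C * B * integral {0..norm z} (\<lambda>t. 1 / \<omega> t)"
proof -
  obtain C where C: "0 \<le> C" "\<And>(f :: 'a \<Rightarrow> complex) B (x::real) (u::'a). f \<in> holo_ball \<Longrightarrow>
       (\<forall>y\<in>ball 0 1. \<omega> (norm y) * cmod (radial_deriv f y) \<le> B) \<Longrightarrow>
       norm u = 1 \<Longrightarrow> 0 \<le> x \<Longrightarrow> x < 1 \<Longrightarrow>
       cmod (frechet_derivative f (at (x *\<^sub>R u)) u) \<le> C * B / \<omega> x"
    by (rule frechet_derivative_bloch_bound[OF cont pos]) (rule that)
  show ?thesis
  proof (rule that[OF C(1)])
    fix f :: "'a \<Rightarrow> complex" and B and z :: 'a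
    assume f: "f \<in> holo_ball" and B: "\<forall>y\<in>ball 0 1. \<omega> (norm y) * cmod (radial_deriv f y) \<le> B"
      and z: "z \<in> ball 0 1"
    show "cmod (f z) \<le> cmod (f 0) + C * B * integral {0..norm z} (\<lambda>t. 1 / \<omega> t)"
    proof (cases "z = 0")
      case False
      then obtain u where u: "norm u = 1" "z = norm z *\<^sub>R u" by (rule exists_unit_direction)
      have "cmod (f (norm z *\<^sub>R u) - f (0 *\<^sub>R u)) \<le> C * B * integral {0..norm z} (\<lambda>t. 1 / \<omega> t)
          - C * B * integral {0..0} (\<lambda>t. 1 / \<omega> t)"
        using z by (intro ray_growth[OF f cont pos _ _ _ u(1)] C(2)[OF f B u(1)]) auto
      then show ?thesis
        using u(2)[symmetric] norm_triangle_ineq2[of "f z" "f 0"] by simp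
    qed simp
  qed
qed

section \<open>Behaviour near the sphere in the little space\<close>

lemma little_bloch_small:
  fixes f :: "'a::complex_normed_vector \<Rightarrow> complex"
  assumes f: "f \<in> little_bloch \<omega>" and "0 < e"
  obtains r where "1/2 \<le> r" "r < 1"
    "\<And>z::'a. r \<le> norm z \<Longrightarrow> norm z < 1 \<Longrightarrow> \<omega> (norm z) * cmod (radial_deriv f z) < e"
proof -
  have "\<forall>\<^sub>F z :: 'a in filtercomap norm (at_left 1). dist (\<omega> (norm z) * cmod (radial_deriv f z)) 0 < e"
    using f \<open>0 < e\<close> by (auto simp: little_bloch_def tendsto_iff)
  then obtain Q where Q: "\<forall>\<^sub>F r in at_left (1::real). Q r"
    "\<And>z::'a. Q (norm z) \<Longrightarrow> dist (\<omega> (norm z) * cmod (radial_deriv f z)) 0 < e"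
    by (auto simp: eventually_filtercomap)
  obtain b where b: "b < 1" "\<And>y. b < y \<Longrightarrow> y < 1 \<Longrightarrow> Q y"
    using Q(1) by (auto simp: eventually_at_left[of 0])
  \<comment> \<open>The midpoint between \<open>b\<close> and 1 turns a strict bound into a weak
    one; at least \<open>1/2\<close> is demanded so that a later division by the radius costs at
    most a factor 2.\<close>
  show ?thesis
  proof (rule that[of "max (1/2) ((b + 1) / 2)"])
    fix z :: 'a assume "max (1/2) ((b + 1) / 2) \<le> norm z" "norm z < 1"
    then have "Q (norm z)" using b by auto
    then show "\<omega> (norm z) * cmod (radial_deriv f z) < e" using Q(2) by fastforce
  qed (use b in auto)
qed

lemma little_blochI:
  fixes f :: "'a::complex_normed_vector \<Rightarrow> complex"
  assumes f: "f \<in> holo_ball" and pos: "\<forall>r\<in>{0..<1}. 0 < \<omega> r"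
    and small: "\<And>e. 0 < e \<Longrightarrow> \<exists>r<1. \<forall>z::'a. r < norm z \<and> norm z < 1 \<longrightarrow> \<omega> (norm z) * cmod (radial_deriv f z) < e"
  shows "f \<in> little_bloch \<omega>"
  unfolding little_bloch_def tendsto_iff
proof (intro CollectI conjI f allI impI)
  fix e :: real assume "0 < e"
  then obtain r where r: "r < 1" "\<And>z::'a. r < norm z \<Longrightarrow> norm z < 1 \<Longrightarrow> \<omega> (norm z) * cmod (radial_deriv f z) < e"
    using small by blast
  have "\<forall>\<^sub>F x in at_left (1::real). r < x \<and> x < 1"
    using r(1) by (auto simp: eventually_at_left[of 0] intro!: exI[of _ r])
  moreover have "dist (\<omega> (norm z) * cmod (radial_deriv f z)) 0 < e" if "r < norm z \<and> norm z < 1" for z :: 'a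
    using r(2)[of z] that pos by (auto simp: less_imp_le)
  ultimately show "\<forall>\<^sub>F z :: 'a in filtercomap norm (at_left 1). dist (\<omega> (norm z) * cmod (radial_deriv f z)) 0 < e"
    unfolding eventually_filtercomap by blast
qed

text \<open>The limit condition bounds the function near the sphere. Further inside, continuity
  would not suffice without compactness, so the bound on the sphere of radius \<open>r\<close> is
  moved inwards by the maximum principle.\<close>

lemma little_bloch_bdd_above:
  fixes f :: "'a::complex_normed_vector \<Rightarrow> complex"
  assumes cont: "continuous_on {0..<1} \<omega>" and pos: "\<forall>r\<in>{0..<1}. 0 < \<omega> r" and f: "f \<in> little_bloch \<omega>"
  shows "bdd_above ((\<lambda>z. \<omega> (norm z) * cmod (radial_deriv f z)) ` ball 0 1)"
proof -
  have fh: "f \<in> holo_ball" using f by (simp add: little_bloch_def)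
  obtain r where r: "1/2 \<le> r" "r < 1"
    "\<And>z::'a. r \<le> norm z \<Longrightarrow> norm z < 1 \<Longrightarrow> \<omega> (norm z) * cmod (radial_deriv f z) < 1"
    by (rule little_bloch_small[OF f zero_less_one]) (rule that)
  obtain m where m: "\<And>x. 0 \<le> x \<Longrightarrow> x \<le> r \<Longrightarrow> \<omega> x \<le> m"
    using bounded_on_subinterval[OF cont r(2)] by auto
  have wr: "0 < \<omega> r" using pos r by simp
  have "0 < m" using wr m[of r] r by simp
  define A where "A = 1 / \<omega> r / r"
  have "0 < A" using wr r by (simp add: A_def)
  have "\<omega> (norm z) * cmod (radial_deriv f z) \<le> max 1 (m * A)" if z: "z \<in> ball 0 1" for z
  proof (cases "z = 0")
    case True
    have "holo_at f 0" using fh by (simp add: holo_ball_iff)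
    then show ?thesis using True linear_0[OF holo_at_linear, of f 0] by (simp add: radial_deriv_def)
  next
    case nz: False
    show ?thesis
    proof (cases "r \<le> norm z")
      case True
      then show ?thesis using r(3)[of z] z by simp
    next
      case False
      obtain u where u: "norm u = 1" "z = norm z *\<^sub>R u" using nz by (rule exists_unit_direction)
      have "cmod (frechet_derivative f (at (norm z *\<^sub>R u)) u) \<le> A"
        unfolding A_def
      proof (rule frechet_derivative_le_radial_deriv[OF fh _ r(2) u(1)])
        show "cmod (radial_deriv f y) \<le> 1 / \<omega> r" if "norm y = r" for y
          using r(3)[of y] r(2) that wr by (simp add: field_simps)
      qed (use r False in auto)
      moreover have "holo_at f (norm z *\<^sub>R u)" using fh z u(2) by (simp add: holo_ball_iff)
      then have "cmod (radial_deriv f z) = norm z * cmod (frechet_derivative f (at (norm z *\<^sub>R u)) u)"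
        using radial_deriv_scaleR[of f "norm z" u] u(2) by (simp add: norm_mult)
      ultimately have "cmod (radial_deriv f z) \<le> 1 * A"
        using z mult_mono[of "norm z" 1 "cmod (frechet_derivative f (at (norm z *\<^sub>R u)) u)" A] by simp
      then have "\<omega> (norm z) * cmod (radial_deriv f z) \<le> m * (1 * A)"
        using m[of "norm z"] False \<open>0 < m\<close> by (intro mult_mono) auto
      then show ?thesis by simp
    qed
  qed
  then show ?thesis by (intro bdd_aboveI2)
qed

section \<open>Norming functionals\<close>

text \<open>Homogeneity is asked only as an inequality, which is easier to check for infima;
  equality follows by using it for \<open>c\<close> and for \<open>inverse c\<close>.\<close>

definition sublinear :: "('a::real_vector \<Rightarrow> real) \<Rightarrow> bool" where
  "sublinear p \<longleftrightarrow> (\<forall>x y. p (x + y) \<le> p x + p y) \<and> (\<forall>c>0. \<forall>x. p (c *\<^sub>R x) \<le> c * p x)"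

lemma sublinear_add: "sublinear p \<Longrightarrow> p (x + y) \<le> p x + p y"
  by (simp add: sublinear_def)

lemma sublinear_0:
  assumes "sublinear p"
  shows "p 0 = 0"
proof -
  have "p (c *\<^sub>R 0) \<le> c * p 0" if "0 < c" for c
    using assms that unfolding sublinear_def by blast
  from this[of "1/2"] this[of 2] show ?thesis by simp
qed

lemma sublinear_scaleR:
  assumes "sublinear p" "0 \<le> c"
  shows "p (c *\<^sub>R x) = c * p x"
proof (cases "c = 0")
  case False
  then have "0 < c" "0 < inverse c" using assms(2) by auto
  then have "p (c *\<^sub>R x) \<le> c * p x" "p (inverse c *\<^sub>R (c *\<^sub>R x)) \<le> inverse c * p (c *\<^sub>R x)"
    using assms(1) unfolding sublinear_def by blast+
  with \<open>0 < c\<close> show ?thesis by (simp add: field_simps)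
qed (simp add: sublinear_0[OF assms(1)])

lemma sublinear_minus_le: "sublinear p \<Longrightarrow> - p (- x) \<le> p x"
  using sublinear_add[of p x "- x"] sublinear_0[of p] by simp

text \<open>A minimal sublinear functional \<open>p\<close> equals its shift along every \<open>y\<close>, and the term for
  \<open>t = 1\<close> then gives \<open>p x + p y \<le> p (x + y)\<close>; so minimal sublinear functionals are linear.\<close>

definition sublinear_shift :: "('a::real_vector \<Rightarrow> real) \<Rightarrow> 'a \<Rightarrow> 'a \<Rightarrow> real" where
  "sublinear_shift p y x = (INF t\<in>{0..}. p (x + t *\<^sub>R y) - t * p y)"

lemma sublinear_shift_le:
  assumes p: "sublinear p" and "0 \<le> t"
  shows "sublinear_shift p y x \<le> p (x + t *\<^sub>R y) - t * p y"
  unfolding sublinear_shift_def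
proof (rule cINF_lower)
  \<comment> \<open>A lower bound independent of the parameter, which makes the infimum a genuine
    one.\<close>
  have "- p (- x) \<le> p (x + s *\<^sub>R y) - s * p y" if "0 \<le> s" for s
    using sublinear_add[OF p, of "x + s *\<^sub>R y" "- x"] sublinear_scaleR[OF p that, of y] by simp
  then show "bdd_below ((\<lambda>t. p (x + t *\<^sub>R y) - t * p y) ` {0..})"
    by (intro bdd_belowI2[of _ "- p (- x)"]) simp
qed (use assms in simp)

lemma le_sublinear_shift:
  assumes "\<And>t. 0 \<le> t \<Longrightarrow> a \<le> p (x + t *\<^sub>R y) - t * p y"
  shows "a \<le> sublinear_shift p y x"
  unfolding sublinear_shift_def using assms by (intro cINF_greatest) auto

text \<open>A parameter \<open>s\<close> for \<open>x\<close> and a parameter \<open>t\<close> for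
  \<open>x'\<close> combine to \<open>s + t\<close> for the sum; scaling \<open>x\<close> by
  \<open>c\<close> scales the parameter by \<open>c\<close>. The infima are taken one after the
  other.\<close>

lemma sublinear_sublinear_shift:
  assumes p: "sublinear p"
  shows "sublinear (sublinear_shift p y)"
  unfolding sublinear_def
proof (intro conjI allI impI)
  fix x x'
  let ?q = "sublinear_shift p y"
  have "?q (x + x') - (p (x + s *\<^sub>R y) - s * p y) \<le> p (x' + t *\<^sub>R y) - t * p y"
    if "0 \<le> s" "0 \<le> t" for s t
    using sublinear_shift_le[OF p, of "s + t" y "x + x'"] that
      sublinear_add[OF p, of "x + s *\<^sub>R y" "x' + t *\<^sub>R y"] by (simp add: algebra_simps)
  then have "?q (x + x') - (p (x + s *\<^sub>R y) - s * p y) \<le> ?q x'" if "0 \<le> s" for s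
    using that by (intro le_sublinear_shift)
  then have "?q (x + x') - ?q x' \<le> p (x + s *\<^sub>R y) - s * p y" if "0 \<le> s" for s
    using that by force
  then have "?q (x + x') - ?q x' \<le> ?q x" by (intro le_sublinear_shift)
  then show "?q (x + x') \<le> ?q x + ?q x'" by simp
next
  fix c :: real and x assume "0 < c"
  let ?q = "sublinear_shift p y"
  have "inverse c * ?q (c *\<^sub>R x) \<le> p (x + t *\<^sub>R y) - t * p y" if "0 \<le> t" for t
  proof -
    have "?q (c *\<^sub>R x) \<le> p (c *\<^sub>R x + (c * t) *\<^sub>R y) - c * t * p y"
      using \<open>0 < c\<close> that by (intro sublinear_shift_le[OF p]) auto
    also have "p (c *\<^sub>R x + (c * t) *\<^sub>R y) = c * p (x + t *\<^sub>R y)"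
      using sublinear_scaleR[OF p, of c "x + t *\<^sub>R y"] \<open>0 < c\<close> by (simp add: scaleR_add_right)
    finally show ?thesis using \<open>0 < c\<close> by (simp add: field_simps)
  qed
  then have "inverse c * ?q (c *\<^sub>R x) \<le> ?q x" by (intro le_sublinear_shift)
  then show "?q (c *\<^sub>R x) \<le> c * ?q x" using \<open>0 < c\<close> by (simp add: field_simps)
qed

text \<open>Hahn-Banach without extending partial functionals: Zorn's lemma, in the reversed order,
  yields a minimal sublinear function below \<open>p\<close>, and minimality forces linearity
  through the shifts.\<close>

lemma exists_linear_le_sublinear:
  fixes p :: "'a::real_vector \<Rightarrow> real"
  assumes p: "sublinear p"
  shows "\<exists>l. linear l \<and> (\<forall>x. l x \<le> p x)"
proof -
  define A where "A = {q. sublinear q \<and> (\<forall>x. q x \<le> p x)}"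
  have "\<exists>m\<in>A. \<forall>q\<in>A. q \<le> m \<longrightarrow> q = m"
  proof (rule predicate_Zorn[of A "\<lambda>q r. r \<le> q"])
    show "partial_order_on A (relation_of (\<lambda>q r. r \<le> q) A)"
      by (rule partial_order_on_relation_ofI) auto
    fix C assume C: "C \<in> Chains (relation_of (\<lambda>q r::'a \<Rightarrow> real. r \<le> q) A)"
    then have CA: "C \<subseteq> A" and chain: "\<And>q r. q \<in> C \<Longrightarrow> r \<in> C \<Longrightarrow> q \<le> r \<or> r \<le> q"
      by (auto simp: Chains_def relation_of_def)
    show "\<exists>u\<in>A. \<forall>q\<in>C. u \<le> q"
    proof (cases "C = {}")
      case True
      then show ?thesis using p by (auto simp: A_def)
    next
      case False
      define u where "u x = (INF q\<in>C. q x)" for x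
      have sub: "sublinear q" and le_p: "q x \<le> p x" if "q \<in> C" for q x
        using that CA by (auto simp: A_def)
      \<comment> \<open>Members of the chain cannot sink without limit at \<open>x\<close>, since
        they dominate their own reflection \<open>- q (- x)\<close> and
        \<open>q (- x) \<le> p (- x)\<close>.\<close>
      have bdd: "bdd_below ((\<lambda>q. q x) ` C)" for x
      proof (rule bdd_belowI2)
        show "- p (- x) \<le> q x" if "q \<in> C" for q
          using sublinear_minus_le[OF sub[OF that], of x] le_p[OF that, of "- x"] by linarith
      qed
      have u_le: "u x \<le> q x" if "q \<in> C" for q x
        unfolding u_def by (rule cINF_lower[OF bdd that])
      have le_u: "a \<le> u x" if "\<And>q. q \<in> C \<Longrightarrow> a \<le> q x" for a x
        unfolding u_def using False that by (rule cINF_greatest)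
      have "sublinear u"
        unfolding sublinear_def
      proof (intro conjI allI impI)
        fix x y
        \<comment> \<open>Near-optimal members at \<open>x\<close> and at \<open>y\<close> may
          differ; being comparable, the smaller one serves at both points.\<close>
        have *: "u (x + y) \<le> q x + r y" if "q \<in> C" "r \<in> C" for q r
          using chain[OF that]
        proof
          assume "q \<le> r"
          then show ?thesis
            using u_le[OF that(1), of "x + y"] sublinear_add[OF sub[OF that(1)], of x y]
            by (smt (verit) le_funD)
        next
          assume "r \<le> q"
          then show ?thesis
            using u_le[OF that(2), of "x + y"] sublinear_add[OF sub[OF that(2)], of x y]
            by (smt (verit) le_funD)
        qed
        have "u (x + y) - q x \<le> u y" if "q \<in> C" for q
          by (rule le_u) (use *[OF that] in \<open>simp add: algebra_simps\<close>)
        then have "u (x + y) - u y \<le> u x"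
          by (intro le_u) (simp add: algebra_simps)
        then show "u (x + y) \<le> u x + u y" by simp
      next
        fix c :: real and x assume "0 < c"
        have "inverse c * u (c *\<^sub>R x) \<le> u x"
        proof (rule le_u)
          fix q assume "q \<in> C"
          then show "inverse c * u (c *\<^sub>R x) \<le> q x"
            using u_le[of q "c *\<^sub>R x"] sublinear_scaleR[OF sub, of q c x] \<open>0 < c\<close>
            by (simp add: field_simps)
        qed
        then show "u (c *\<^sub>R x) \<le> c * u x" using \<open>0 < c\<close> by (simp add: field_simps)
      qed
      moreover have "u x \<le> p x" for x
        using False u_le le_p order_trans by blast
      ultimately show ?thesis
        using u_le by (intro bexI[of _ u]) (auto simp: A_def le_fun_def)
    qed
  qed
  then obtain m where m: "sublinear m" "\<And>x. m x \<le> p x"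
    and min: "\<And>q. sublinear q \<Longrightarrow> (\<And>x. q x \<le> p x) \<Longrightarrow> q \<le> m \<Longrightarrow> q = m"
    by (auto simp: A_def)
  have "sublinear_shift m y = m" for y
  proof (rule min[OF sublinear_sublinear_shift[OF m(1)]])
    have *: "sublinear_shift m y x \<le> m x" for x
      using sublinear_shift_le[OF m(1), of 0 y x] by simp
    then show "sublinear_shift m y \<le> m" by (rule le_funI)
    show "sublinear_shift m y x \<le> p x" for x using *[of x] m(2)[of x] by simp
  qed
  then have add: "m (x + y) = m x + m y" for x y
    using sublinear_shift_le[OF m(1), of 1 y x] sublinear_add[OF m(1), of x y] by simp
  have "linear m"
  proof (rule linearI[OF add])
    fix c :: real and x
    show "m (c *\<^sub>R x) = c *\<^sub>R m x"
    proof (cases "0 \<le> c")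
      case True
      then show ?thesis using sublinear_scaleR[OF m(1)] by simp
    next
      case False
      have "m (c *\<^sub>R x) + m ((- c) *\<^sub>R x) = 0"
        using add[of "c *\<^sub>R x" "(- c) *\<^sub>R x"] sublinear_0[OF m(1)] by simp
      then show ?thesis using sublinear_scaleR[OF m(1), of "- c" x] False by simp
    qed
  qed
  with m(2) show ?thesis by blast
qed

text \<open>Shifting the norm along \<open>w\<close> beforehand fixes the value at \<open>w\<close>:
  the term \<open>t = 1\<close> at \<open>- w\<close> gives \<open>l (- w) \<le> - norm w\<close>,
  while \<open>t = 0\<close> keeps \<open>l\<close> below the norm.\<close>

lemma exists_real_norming_functional:
  fixes w :: "'a::real_normed_vector"
  shows "\<exists>l. linear l \<and> (\<forall>x. l x \<le> norm x) \<and> l w = norm w"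
proof -
  have norm: "sublinear (norm :: 'a \<Rightarrow> real)"
    by (simp add: sublinear_def norm_triangle_ineq)
  obtain l where l: "linear l" "\<And>x. l x \<le> sublinear_shift norm w x"
    using exists_linear_le_sublinear[OF sublinear_sublinear_shift[OF norm]] by blast
  have le: "l x \<le> norm x" for x
    using l(2)[of x] sublinear_shift_le[OF norm, of 0 w x] by simp
  have "l (- w) \<le> - norm w"
    using l(2)[of "- w"] sublinear_shift_le[OF norm, of 1 w "- w"] by simp
  then have "l w = norm w"
    using linear_neg[OF l(1), of w] le[of w] by simp
  with l(1) le show ?thesis by blast
qed

text \<open>The usual complexification of a real functional. Rotating \<open>x\<close> by the
  conjugate phase of \<open>L x\<close> makes the value real, so the real bound applies. At
  \<open>w\<close> the real part already exhausts the bound, which kills the imaginary part.\<close>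

lemma exists_norming_functional:
  fixes w :: "'a::complex_normed_vector"
  obtains L :: "'a \<Rightarrow> complex" where "bounded_linear L" "\<And>c x. L (scaleC c x) = c * L x"
    "\<And>x. cmod (L x) \<le> norm x" "L w = norm w"
proof -
  obtain l where l: "linear l" "\<And>x::'a. l x \<le> norm x" "l w = norm w"
    using exists_real_norming_functional by blast
  define L where "L x = Complex (l x) (- l (scaleC \<i> x))" for x
  have add: "L (x + y) = L x + L y" for x y
    by (simp add: L_def scaleC_add_right linear_add[OF l(1)] complex_eq_iff)
  have real: "L (r *\<^sub>R x) = of_real r * L x" for r x
    by (simp add: L_def scaleC_scaleR_commute linear_scale[OF l(1)] complex_eq_iff)
  have i: "L (scaleC \<i> x) = \<i> * L x" for x
  proof -
    have "scaleC \<i> (scaleC \<i> x) = (-1) *\<^sub>R x"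
      by (simp only: scaleR_scaleC scaleC_scaleC) simp
    then show ?thesis by (simp add: L_def linear_neg[OF l(1)] complex_eq_iff)
  qed
  have scale: "L (scaleC c x) = c * L x" for c x
  proof -
    have "scaleC c x = scaleC (of_real (Re c) + of_real (Im c) * \<i>) x"
      by (simp add: complex_eq[symmetric] mult.commute)
    also have "\<dots> = Re c *\<^sub>R x + Im c *\<^sub>R scaleC \<i> x"
      by (simp add: scaleC_add_left scaleR_scaleC scaleC_scaleC)
    finally have "L (scaleC c x) = (of_real (Re c) + of_real (Im c) * \<i>) * L x"
      by (simp add: add real i distrib_right)
    then show ?thesis by (simp add: complex_eq[symmetric] mult.commute)
  qed
  have bnd: "cmod (L x) \<le> norm x" for x
  proof -
    define c where "c = cnj (sgn (L x))"
    have c: "cmod c \<le> 1" by (simp add: c_def norm_sgn)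
    have "c * L x = cmod (L x)"
    proof (cases "L x = 0")
      case False
      have "c * L x = L x * cnj (L x) / cmod (L x)"
        by (simp add: c_def sgn_eq)
      also have "\<dots> = cmod (L x)"
        using False by (simp add: complex_norm_square[symmetric] power2_eq_square)
      finally show ?thesis .
    qed simp
    then have "L (scaleC c x) = cmod (L x)" by (simp add: scale)
    then have "cmod (L x) = l (scaleC c x)" by (simp add: L_def complex_eq_iff)
    also have "\<dots> \<le> cmod c * norm x" using l(2)[of "scaleC c x"] by (simp add: norm_scaleC)
    also have "\<dots> \<le> norm x" using c by (simp add: mult_left_le_one_le)
    finally show ?thesis .
  qed
  have "bounded_linear L"
    by (rule bounded_linear_intro[of _ 1]) (simp_all add: add real scaleR_conv_of_real bnd)
  moreover have "L w = norm w"
  proof -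
    have "Re (L w) = norm w" by (simp add: L_def l(3))
    moreover have "(Re (L w))\<^sup>2 + (Im (L w))\<^sup>2 \<le> (norm w)\<^sup>2"
      using bnd[of w] by (metis cmod_power2 norm_ge_zero power_mono)
    ultimately show ?thesis by (simp add: complex_eq_iff)
  qed
  ultimately show ?thesis using that scale bnd by blast
qed

section \<open>Lacunary sums for normal weights\<close>

text \<open>The right side is the maximum of the left, attained at \<open>y = p\<close>; it comes
  from \<open>ln u \<le> u - 1\<close> at \<open>u = y / p\<close>.\<close>

lemma powr_mult_exp_neg_le:
  fixes y p :: real
  assumes "0 < y" "0 < p"
  shows "y powr p * exp (- y) \<le> exp (p * ln p - p)"
proof -
  have "ln (y / p) \<le> y / p - 1" using assms by (intro ln_le_minus_one) simp
  then have "p * (ln y - ln p) \<le> p * (y / p - 1)"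
    using assms by (intro mult_left_mono) (simp_all add: ln_div)
  then have "p * ln y - y \<le> p * ln p - p" using assms by (simp add: algebra_simps)
  then show ?thesis
    using assms by (simp add: powr_def exp_add[symmetric])
qed

text \<open>With \<open>\<psi> y = y\<^sup>a / (1 + y\<^sup>a)\<close> each summand is at most a constant times
  \<open>\<psi> (2 y) - \<psi> y\<close>, and these differences telescope.\<close>

lemma dyadic_powr_exp_sum_bounded:
  fixes a :: real
  assumes "0 < a"
  obtains C where "0 \<le> C"
    "\<And>x K J. 0 < x \<Longrightarrow> (\<Sum>k=K..J. (2 ^ k * x) powr a * exp (- (2 ^ k * x))) \<le> C"
proof -
  define \<psi> where "\<psi> y = y powr a / (1 + y powr a)" for y :: real
  define q where "q = (2::real) powr a"
  define E where "E = exp ((2 * a) * ln (2 * a) - 2 * a)"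
  \<comment> \<open>With \<open>Y = y powr a\<close>, the increment of \<psi> from \<open>y\<close>
    to \<open>2 * y\<close> is \<open>(q - 1) * Y / ((1 + q * Y) * (1 + Y))\<close>. The numerator
    of \<open>C\<close> bounds \<open>exp (- y)\<close> times this denominator, \<open>E\<close>
    being the maximum of \<open>Y\<^sup>2 * exp (- y)\<close>.\<close>
  define C where "C = (2 + 2 * q\<^sup>2 * E) / (q - 1)"
  have "1 < q" using \<open>0 < a\<close> by (simp add: q_def)
  have "0 < C" using \<open>1 < q\<close> by (simp add: C_def E_def add_pos_nonneg)
  have step: "y powr a * exp (- y) \<le> C * (\<psi> (2 * y) - \<psi> y)" if "0 < y" for y :: real
  proof -
    define Y where "Y = y powr a"
    have "0 < Y" using that by (simp add: Y_def)
    have "Y\<^sup>2 * exp (- y) \<le> E"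
      using powr_mult_exp_neg_le[OF that, of "2 * a"] \<open>0 < a\<close> that
      by (simp add: Y_def E_def power2_eq_square powr_add[symmetric])
    have "(1 + q * Y) * (1 + Y) \<le> (1 + q * Y) * (1 + q * Y)"
      using \<open>1 < q\<close> \<open>0 < Y\<close> by (intro mult_left_mono) auto
    also have "\<dots> \<le> 2 + 2 * q\<^sup>2 * Y\<^sup>2"
      using sum_squares_bound[of 1 "q * Y"] by (simp add: power2_eq_square algebra_simps)
    finally have "exp (- y) * ((1 + q * Y) * (1 + Y)) \<le> exp (- y) * (2 + 2 * q\<^sup>2 * Y\<^sup>2)"
      by (intro mult_left_mono) auto
    also have "\<dots> = 2 * exp (- y) + 2 * q\<^sup>2 * (Y\<^sup>2 * exp (- y))" by (simp add: algebra_simps)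
    also have "\<dots> \<le> 2 * 1 + 2 * q\<^sup>2 * E"
      using \<open>Y\<^sup>2 * exp (- y) \<le> E\<close> that by (intro add_mono mult_left_mono) auto
    also have "\<dots> = C * (q - 1)" using \<open>1 < q\<close> by (simp add: C_def)
    finally have "exp (- y) \<le> C * (q - 1) / ((1 + q * Y) * (1 + Y))"
      using \<open>0 < Y\<close> \<open>1 < q\<close> by (simp add: pos_le_divide_eq add_pos_pos)
    then have "Y * exp (- y) \<le> Y * (C * (q - 1) / ((1 + q * Y) * (1 + Y)))"
      using \<open>0 < Y\<close> by (intro mult_left_mono) auto
    also have "\<dots> = C * (q * Y / (1 + q * Y) - Y / (1 + Y))"
    proof -
      have "1 + q * Y \<noteq> 0" "1 + Y \<noteq> 0" using \<open>0 < Y\<close> \<open>1 < q\<close> by (smt (verit) mult_pos_pos)+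
      then show ?thesis by (simp add: divide_simps) (simp add: algebra_simps)
    qed
    also have "\<dots> = C * (\<psi> (2 * y) - \<psi> y)"
      using that by (simp add: \<psi>_def Y_def q_def powr_mult)
    finally show ?thesis by (simp add: Y_def)
  qed
  have \<psi>: "0 \<le> \<psi> y" "\<psi> y \<le> 1" for y
    by (auto simp: \<psi>_def divide_le_eq add_pos_nonneg)
  have "(\<Sum>k=K..J. (2 ^ k * x) powr a * exp (- (2 ^ k * x))) \<le> C" if "0 < x" for x K J
  proof (cases "K \<le> Suc J")
    case True
    have "(\<Sum>k=K..J. (2 ^ k * x) powr a * exp (- (2 ^ k * x)))
        \<le> (\<Sum>k=K..J. C * (\<psi> (2 ^ Suc k * x) - \<psi> (2 ^ k * x)))"
      using step that by (intro sum_mono) (simp add: mult.assoc)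
    also have "\<dots> = C * (\<psi> (2 ^ Suc J * x) - \<psi> (2 ^ K * x))"
      using sum_Suc_diff[OF True, of "\<lambda>k. \<psi> (2 ^ k * x)"] by (simp add: sum_distrib_left[symmetric])
    also have "\<dots> \<le> C * 1"
      using \<psi>[of "2 ^ Suc J * x"] \<psi>[of "2 ^ K * x"] \<open>0 < C\<close> by (intro mult_left_mono) auto
    finally show ?thesis by simp
  qed (use \<open>0 < C\<close> in simp)
  with \<open>0 < C\<close> show ?thesis by (intro that[of C]) auto
qed

section \<open>Integrals and power comparison for normal weights\<close>

lemma integrable_reciprocal:
  fixes \<omega> :: "real \<Rightarrow> real"
  assumes cont: "continuous_on {0..<1} \<omega>" and pos: "\<forall>r\<in>{0..<1}. 0 < \<omega> r" and "0 \<le> s" "r < 1"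
  shows "(\<lambda>t. 1 / \<omega> t) integrable_on {s..r}"
proof (intro integrable_continuous_real continuous_on_divide continuous_on_const)
  have sub: "{s..r} \<subseteq> {0..<1}" using assms by auto
  then show "continuous_on {s..r} \<omega>" using cont continuous_on_subset by blast
  show "\<forall>t\<in>{s..r}. \<omega> t \<noteq> 0" using sub pos by fastforce
qed

lemma integral_reciprocal_nonneg:
  fixes \<omega> :: "real \<Rightarrow> real"
  assumes "continuous_on {0..<1} \<omega>" and pos: "\<forall>r\<in>{0..<1}. 0 < \<omega> r" and "r < 1"
  shows "0 \<le> integral {0..r} (\<lambda>t. 1 / \<omega> t)"
  using assms by (intro integral_nonneg integrable_reciprocal) (auto simp: less_imp_le)

text \<open>Normality in terms of the distance to 1. Adding the two powers removes the distinction
  between \<open>x \<le> s\<close> and \<open>s \<le> x\<close>, so one inequality serves in both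
  directions.\<close>

lemma normal_fun_ratio:
  assumes "normal_fun \<omega>"
  obtains d a b where "0 < d" "d \<le> 1" "0 < a" "0 < b"
    "\<And>x s. 0 < x \<Longrightarrow> x \<le> d \<Longrightarrow> 0 < s \<Longrightarrow> s \<le> d \<Longrightarrow>
       \<omega> (1 - x) \<le> ((x / s) powr a + (x / s) powr b) * \<omega> (1 - s)"
proof -
  have pos: "\<forall>r\<in>{0..<1}. 0 < \<omega> r" using assms by (simp add: normal_fun_def)
  obtain \<delta> a b where n: "0 \<le> \<delta>" "\<delta> < 1" "0 < a" "a < b"
    "antimono_on {\<delta>..<1} (\<lambda>r. \<omega> r / (1 - r) powr a)" "mono_on {\<delta>..<1} (\<lambda>r. \<omega> r / (1 - r) powr b)"
    using assms unfolding normal_fun_def by blast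
  show ?thesis
  proof (rule that[of "1 - \<delta>" a b])
    fix x s assume x: "0 < x" "x \<le> 1 - \<delta>" and s: "0 < s" "s \<le> 1 - \<delta>"
    have ws: "0 < \<omega> (1 - s)" using pos s n by simp
    have "\<omega> (1 - x) \<le> (x / s) powr a * \<omega> (1 - s) \<or> \<omega> (1 - x) \<le> (x / s) powr b * \<omega> (1 - s)"
    proof (cases "x \<le> s")
      case True
      have "\<omega> (1 - x) / (1 - (1 - x)) powr a \<le> \<omega> (1 - s) / (1 - (1 - s)) powr a"
        by (rule monotone_onD[OF n(5)]) (use x s True n in auto)
      then show ?thesis using x s by (simp add: powr_divide field_simps)
    next
      case False
      have "\<omega> (1 - x) / (1 - (1 - x)) powr b \<le> \<omega> (1 - s) / (1 - (1 - s)) powr b"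
        by (rule monotone_onD[OF n(6)]) (use x s False n in auto)
      then show ?thesis using x s by (simp add: powr_divide field_simps)
    qed
    moreover have "0 \<le> (x / s) powr a * \<omega> (1 - s)" "0 \<le> (x / s) powr b * \<omega> (1 - s)"
      using ws by simp_all
    ultimately show "\<omega> (1 - x) \<le> ((x / s) powr a + (x / s) powr b) * \<omega> (1 - s)"
      by (simp add: distrib_right) linarith
  qed (use n in auto)
qed

text \<open>The comparison with the fixed distance \<open>d\<close> gives decay like a power. This
  is what puts functions with bounded radial derivative into the little space.\<close>

lemma normal_fun_tendsto_0:
  assumes "normal_fun \<omega>"
  shows "(\<omega> \<longlongrightarrow> 0) (at_left 1)"
proof -
  have pos: "\<forall>r\<in>{0..<1}. 0 < \<omega> r" using assms by (simp add: normal_fun_def)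
  obtain d a b where n: "0 < d" "d \<le> 1" "0 < a" "0 < b"
    "\<And>x s. 0 < x \<Longrightarrow> x \<le> d \<Longrightarrow> 0 < s \<Longrightarrow> s \<le> d \<Longrightarrow>
       \<omega> (1 - x) \<le> ((x / s) powr a + (x / s) powr b) * \<omega> (1 - s)"
    by (rule normal_fun_ratio[OF assms]) (rule that)
  have near: "\<forall>\<^sub>F t in at_left (1::real). 1 - d < t \<and> t < 1"
    using n by (auto simp: eventually_at_left[of 0] intro!: exI[of _ "1 - d"])
  show ?thesis
  proof (rule tendsto_sandwich[OF _ _ tendsto_const])
    show "\<forall>\<^sub>F t in at_left 1. 0 \<le> \<omega> t"
      using near by eventually_elim (use pos n in \<open>auto simp: less_imp_le\<close>)
    show "\<forall>\<^sub>F t in at_left 1. \<omega> t \<le> (((1 - t) / d) powr a + ((1 - t) / d) powr b) * \<omega> (1 - d)"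
      using near
    proof eventually_elim
      case (elim t)
      then show ?case using n(5)[of "1 - t" d] n(1) by simp
    qed
    have lim: "((\<lambda>t. (1 - t) / d) \<longlongrightarrow> 0) (at_left 1)"
      using n(1) by (auto intro!: tendsto_eq_intros)
    have "((\<lambda>t. ((1 - t) / d) powr c) \<longlongrightarrow> 0) (at_left 1)" if "0 < c" for c
    proof (rule tendsto_zero_powrI[OF lim tendsto_const _ that])
      show "\<forall>\<^sub>F t in at_left 1. 0 \<le> (1 - t) / d"
        using near by eventually_elim (use n in auto)
    qed
    from tendsto_mult_left_zero[OF tendsto_add_zero[OF this[OF n(3)] this[OF n(4)]]]
    show "((\<lambda>t. (((1 - t) / d) powr a + ((1 - t) / d) powr b) * \<omega> (1 - d)) \<longlongrightarrow> 0) (at_left 1)" .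
  qed
qed

text \<open>Bernoulli's inequality with the full exponent gives only 0; with half the exponent it
  gives \<open>1/2\<close>, which is then squared.\<close>

lemma one_minus_inverse_power_ge:
  assumes "1 \<le> (J::nat)"
  shows "1 / 4 \<le> (1 - 1 / 2 ^ J :: real) ^ (2 ^ J)"
proof -
  obtain i where J: "J = Suc i" using assms by (cases J) auto
  have "1 + real (2 ^ i) * (- (1 / 2 ^ J)) \<le> (1 + (- (1 / 2 ^ J))) ^ (2 ^ i)"
    by (rule Bernoulli_inequality) simp
  then have "1 / 2 \<le> (1 - 1 / 2 ^ J :: real) ^ (2 ^ i)" by (simp add: J)
  then have "(1 / 2)\<^sup>2 \<le> ((1 - 1 / 2 ^ J :: real) ^ (2 ^ i))\<^sup>2"
    by (rule power_mono) simp
  also have "\<dots> = (1 - 1 / 2 ^ J) ^ (2 ^ J)"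
    by (simp add: power_mult[symmetric] J mult.commute)
  finally show ?thesis by (simp add: power2_eq_square)
qed

text \<open>With \<open>x = 1 - r\<close>, the power \<open>r ^ (2 ^ k)\<close> is at most
  \<open>exp (- (2 ^ k * x))\<close> and the quotient of weights is bounded by powers of
  \<open>2 ^ k * x\<close>, so the first sum reduces to dyadic sums bounded for every
  \<open>J\<close>. For the second bound the integral is cut at the points
  \<open>1 - 2^(-k)\<close>; stopping at the shell that contains \<open>r\<close> keeps all powers
  of \<open>r\<close> above \<open>1/4\<close>.\<close>

lemma lacunary_sum_bounds:
  assumes "normal_fun \<omega>"
  obtains K C where "0 \<le> C"
    "\<And>J r. 0 \<le> r \<Longrightarrow> r < 1 \<Longrightarrow> \<omega> r * (\<Sum>k=K..J. r ^ (2 ^ k) / \<omega> (1 - 1 / 2 ^ k)) \<le> C"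
    "\<And>r. 0 \<le> r \<Longrightarrow> r < 1 \<Longrightarrow> \<exists>J. integral {0..r} (\<lambda>t. 1 / \<omega> t)
       \<le> C + C * (\<Sum>k=K..J. r ^ (2 ^ k) / (2 ^ k * \<omega> (1 - 1 / 2 ^ k)))"
proof -
  have pos: "\<forall>r\<in>{0..<1}. 0 < \<omega> r" and cont: "continuous_on {0..<1} \<omega>"
    using assms by (auto simp: normal_fun_def)
  obtain d a b where n: "0 < d" "d \<le> 1" "0 < a" "0 < b"
    "\<And>x s. 0 < x \<Longrightarrow> x \<le> d \<Longrightarrow> 0 < s \<Longrightarrow> s \<le> d \<Longrightarrow>
       \<omega> (1 - x) \<le> ((x / s) powr a + (x / s) powr b) * \<omega> (1 - s)"
    by (rule normal_fun_ratio[OF assms]) (rule that)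
  obtain A where A: "0 \<le> A"
    "\<And>x K J. 0 < x \<Longrightarrow> (\<Sum>k=K..J. (2 ^ k * x) powr a * exp (- (2 ^ k * x))) \<le> A"
    by (rule dyadic_powr_exp_sum_bounded[OF n(3)]) (rule that)
  obtain B where B: "0 \<le> B"
    "\<And>x K J. 0 < x \<Longrightarrow> (\<Sum>k=K..J. (2 ^ k * x) powr b * exp (- (2 ^ k * x))) \<le> B"
    by (rule dyadic_powr_exp_sum_bounded[OF n(4)]) (rule that)
  obtain K' where K': "(1/2) ^ K' < d"
    using real_arch_pow_inv[OF n(1), of "1/2"] by auto
  \<comment> \<open>The successor guarantees \<open>1 \<le> K\<close>: the lower bound
    \<open>1/4\<close> needs a positive index, and the sum from \<open>K\<close> to 0 has to be
    empty.\<close>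
  define K where "K = Suc K'"
  have "(1/2::real) ^ K \<le> (1/2) ^ K'" by (simp add: K_def)
  with K' have Kd: "1 / 2 ^ K \<le> d" by (simp add: power_one_over)
  have small: "0 < 1 / (2::real) ^ k" "1 / (2::real) ^ k \<le> d" if "K \<le> k" for k
  proof -
    have "1 / (2::real) ^ k \<le> 1 / 2 ^ K" using that by (intro divide_left_mono power_increasing) auto
    then show "1 / (2::real) ^ k \<le> d" using Kd by simp
  qed simp
  have wk: "0 < \<omega> (1 - 1 / 2 ^ k)" for k using pos by simp
  have up: "\<omega> r * (\<Sum>k=K..J. r ^ (2 ^ k) / \<omega> (1 - 1 / 2 ^ k)) \<le> A + B"
    if r: "1 - 1 / 2 ^ K \<le> r" "r < 1" for J r
  proof -
    define x where "x = 1 - r"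
    have x: "0 < x" "x \<le> d" "x \<le> 1" using r Kd n by (auto simp: x_def)
    have "\<omega> r * (\<Sum>k=K..J. r ^ (2 ^ k) / \<omega> (1 - 1 / 2 ^ k))
        = (\<Sum>k=K..J. \<omega> r * r ^ (2 ^ k) / \<omega> (1 - 1 / 2 ^ k))"
      by (simp add: sum_distrib_left)
    also have "\<dots> \<le> (\<Sum>k=K..J. (2 ^ k * x) powr a * exp (- (2 ^ k * x)) + (2 ^ k * x) powr b * exp (- (2 ^ k * x)))"
    proof (rule sum_mono)
      fix k assume "k \<in> {K..J}"
      then have k: "K \<le> k" by simp
      have "\<omega> r \<le> ((x / (1 / 2 ^ k)) powr a + (x / (1 / 2 ^ k)) powr b) * \<omega> (1 - 1 / 2 ^ k)"
        using n(5)[OF x(1,2) small[OF k]] by (simp add: x_def)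
      then have 1: "\<omega> r / \<omega> (1 - 1 / 2 ^ k) \<le> (2 ^ k * x) powr a + (2 ^ k * x) powr b"
        using wk[of k] by (simp add: field_simps)
      have "r \<le> exp (- x)" using exp_ge_add_one_self[of "- x"] by (simp add: x_def)
      then have "r ^ (2 ^ k) \<le> exp (- x) ^ (2 ^ k)"
        using x by (intro power_mono) (auto simp: x_def)
      also have "\<dots> = exp (- (2 ^ k * x))" by (simp add: exp_of_nat_mult[symmetric])
      finally have "r ^ (2 ^ k) \<le> exp (- (2 ^ k * x))" .
      then have "(\<omega> r / \<omega> (1 - 1 / 2 ^ k)) * r ^ (2 ^ k)
          \<le> ((2 ^ k * x) powr a + (2 ^ k * x) powr b) * exp (- (2 ^ k * x))"
        using 1 x by (intro mult_mono) (auto simp: x_def)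
      then show "\<omega> r * r ^ (2 ^ k) / \<omega> (1 - 1 / 2 ^ k)
          \<le> (2 ^ k * x) powr a * exp (- (2 ^ k * x)) + (2 ^ k * x) powr b * exp (- (2 ^ k * x))"
        by (simp add: distrib_right)
    qed
    also have "\<dots> \<le> A + B"
      using A(2)[OF x(1)] B(2)[OF x(1)] by (simp add: sum.distrib add_mono)
    finally show ?thesis .
  qed
  define r0 where "r0 = 1 - 1 / (2::real) ^ K"
  have r0: "0 \<le> r0" "r0 < 1" by (simp_all add: r0_def)
  obtain m where m: "\<And>x. 0 \<le> x \<Longrightarrow> x \<le> r0 \<Longrightarrow> \<omega> x \<le> m"
    using bounded_on_subinterval[OF cont r0(2)] by auto
  have "0 < \<omega> r0" using pos r0 by simp
  then have "0 < m" using m[of r0] r0 by simp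
  \<comment> \<open>The second entry serves radii below \<open>r0\<close>: there the sum is at most
    its value at \<open>r0\<close>, and the weight is at most \<open>m\<close>.\<close>
  define C1 where "C1 = max (A + B) (m * ((A + B) / \<omega> r0))"
  have up': "\<omega> r * (\<Sum>k=K..J. r ^ (2 ^ k) / \<omega> (1 - 1 / 2 ^ k)) \<le> C1" if r: "0 \<le> r" "r < 1" for J r
  proof (cases "r0 \<le> r")
    case True
    then show ?thesis using up[of r J] r by (simp add: r0_def C1_def)
  next
    case False
    have "(\<Sum>k=K..J. r ^ (2 ^ k) / \<omega> (1 - 1 / 2 ^ k)) \<le> (\<Sum>k=K..J. r0 ^ (2 ^ k) / \<omega> (1 - 1 / 2 ^ k))"
      using r False wk by (intro sum_mono divide_right_mono power_mono) (auto simp: less_imp_le)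
    also have "\<dots> \<le> (A + B) / \<omega> r0"
      using up[of r0 J] r0 \<open>0 < \<omega> r0\<close> by (simp add: r0_def field_simps)
    finally have "\<omega> r * (\<Sum>k=K..J. r ^ (2 ^ k) / \<omega> (1 - 1 / 2 ^ k)) \<le> m * ((A + B) / \<omega> r0)"
      using m[of r] False r \<open>0 < m\<close> wk by (intro mult_mono sum_nonneg) (auto simp: less_imp_le)
    then show ?thesis by (simp add: C1_def)
  qed
  let ?I = "\<lambda>r. integral {0..r} (\<lambda>t. 1 / \<omega> t)"
  have int: "(\<lambda>t. 1 / \<omega> t) integrable_on {s..r}" if "0 \<le> s" "r < 1" for s r
    by (rule integrable_reciprocal[OF cont pos that])
  have I_mono: "?I s \<le> ?I r" if "0 \<le> s" "s \<le> r" "r < 1" for s r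
    using that int pos by (intro integral_subset_le) (auto simp: less_imp_le)
  define D where "D = 2 powr a + 2 powr b"
  have "0 \<le> D" by (simp add: D_def)
  \<comment> \<open>On this shell the distance to 1 shrinks at most by half, so
    \<open>\<omega> (1 - 1 / 2 ^ k)\<close> is at most \<open>D\<close> times the weight at any of
    its points.\<close>
  have block: "?I (1 - 1 / 2 ^ Suc k) \<le> ?I (1 - 1 / 2 ^ k) + D * (1 / (2 ^ k * \<omega> (1 - 1 / 2 ^ k)))"
    if k: "K \<le> k" for k
  proof -
    let ?s = "1 - 1 / (2::real) ^ k" and ?r = "1 - 1 / (2::real) ^ Suc k"
    have le: "0 \<le> ?s" "?s \<le> ?r" "?r < 1" by (simp_all add: field_simps)
    have "?I ?s + integral {?s..?r} (\<lambda>t. 1 / \<omega> t) = ?I ?r"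
      using le int[of 0 ?r] by (intro Henstock_Kurzweil_Integration.integral_combine) auto
    moreover have "integral {?s..?r} (\<lambda>t. 1 / \<omega> t) \<le> integral {?s..?r} (\<lambda>t. D / \<omega> ?s)"
    proof (rule integral_le[OF int[OF le(1,3)]])
      fix t assume t: "t \<in> {?s..?r}"
      define x where "x = 1 - t"
      have x: "1 / 2 ^ Suc k \<le> x" "x \<le> 1 / 2 ^ k" using t by (auto simp: x_def)
      have "0 < x" using x(1) by (rule less_le_trans[rotated]) simp
      have "(1 / 2 ^ k) / x \<le> 2" using x(1) \<open>0 < x\<close> by (simp add: field_simps)
      then have "((1 / 2 ^ k) / x) powr a + ((1 / 2 ^ k) / x) powr b \<le> D"
        unfolding D_def using n \<open>0 < x\<close> by (intro add_mono powr_mono2) auto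
      moreover have "x \<le> d" using x(2) small(2)[OF k] by simp
      have "?s \<le> t" "t \<le> ?r" using t by auto
      with le have "0 \<le> t" "t < 1" by linarith+
      then have "0 < \<omega> t" using pos by simp
      then have "0 \<le> \<omega> (1 - x)" by (simp add: x_def)
      ultimately have "\<omega> ?s \<le> D * \<omega> (1 - x)"
        using n(5)[OF small[OF k] \<open>0 < x\<close> \<open>x \<le> d\<close>] by (meson mult_right_mono order_trans)
      then show "1 / \<omega> t \<le> D / \<omega> ?s"
        using \<open>0 < \<omega> t\<close> wk[of k] by (simp add: x_def field_simps)
    qed (rule integrable_const_ivl)
    moreover have "integral {?s..?r} (\<lambda>t. D / \<omega> ?s) = 1 / 2 ^ Suc k * (D / \<omega> ?s)"
      using le by (simp add: field_simps)
    moreover have "1 / 2 ^ Suc k * (D / \<omega> ?s) \<le> D * (1 / (2 ^ k * \<omega> ?s))"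
      using \<open>0 \<le> D\<close> wk[of k] by (simp add: field_simps)
    ultimately show ?thesis by linarith
  qed
  have blocks: "?I (1 - 1 / 2 ^ Suc J) \<le> ?I r0 + D * (\<Sum>k=K..J. 1 / (2 ^ k * \<omega> (1 - 1 / 2 ^ k)))"
    if "K \<le> J" for J
    using that
  proof (induction J rule: dec_induct)
    case base
    then show ?case using block[of K] by (simp add: r0_def)
  next
    case (step J)
    then show ?case using block[of "Suc J"] by (simp add: distrib_left)
  qed
  define C2 where "C2 = max (?I r0) (4 * D)"
  have "0 \<le> C2" using \<open>0 \<le> D\<close> by (simp add: C2_def)
  have low: "\<exists>J. ?I r \<le> C2 + C2 * (\<Sum>k=K..J. r ^ (2 ^ k) / (2 ^ k * \<omega> (1 - 1 / 2 ^ k)))"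
    if r: "0 \<le> r" "r < 1" for r
  proof (cases "r0 \<le> r")
    case False
    then have "?I r \<le> C2" using I_mono[of r r0] r r0 by (simp add: C2_def)
    then show ?thesis by (intro exI[of _ 0]) (simp add: K_def)
  next
    case True
    obtain N where "(1/2) ^ N < 1 - r" using real_arch_pow_inv[of "1 - r" "1/2"] r by auto
    then have N: "r < 1 - 1 / 2 ^ N" by (simp add: power_one_over)
    \<comment> \<open>The least \<open>n\<close> with \<open>P n\<close> exceeds \<open>K\<close>
      because \<open>r0 \<le> r\<close>, so subtracting 1 is exact and \<open>r\<close> lies between
      \<open>1 - 2^(-J)\<close> and \<open>1 - 2^(-J-1)\<close>.\<close>
    define P where "P n \<longleftrightarrow> r < 1 - 1 / (2::real) ^ n" for n :: nat
    define J where "J = (LEAST n. P n) - 1"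
    have "P (LEAST n. P n)" using N by (intro LeastI[of P N]) (simp add: P_def)
    have "K < (LEAST n. P n)"
    proof (rule ccontr)
      assume "\<not> K < (LEAST n. P n)"
      then have "1 - 1 / (2::real) ^ (LEAST n. P n) \<le> r0"
        unfolding r0_def by (intro diff_left_mono divide_left_mono power_increasing) auto
      then show False using \<open>P (LEAST n. P n)\<close> True by (simp add: P_def)
    qed
    then have J: "K \<le> J" "Suc J = (LEAST n. P n)" by (auto simp: J_def)
    have "\<not> P J" using J(2) by (intro not_less_Least) simp
    then have rJ: "1 - 1 / 2 ^ J \<le> r" by (simp add: P_def)
    have "P (Suc J)" unfolding J(2) by fact
    then have rSJ: "r < 1 - 1 / 2 ^ Suc J" by (simp only: P_def)
    have "?I r \<le> ?I (1 - 1 / 2 ^ Suc J)" using r rSJ by (intro I_mono) auto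
    also have "\<dots> \<le> ?I r0 + D * (\<Sum>k=K..J. 1 / (2 ^ k * \<omega> (1 - 1 / 2 ^ k)))"
      by (rule blocks[OF J(1)])
    also have "(\<Sum>k=K..J. 1 / (2 ^ k * \<omega> (1 - 1 / 2 ^ k)))
        \<le> (\<Sum>k=K..J. 4 * (r ^ (2 ^ k) / (2 ^ k * \<omega> (1 - 1 / 2 ^ k))))"
    proof (rule sum_mono)
      fix k assume k: "k \<in> {K..J}"
      have "1 / 4 \<le> (1 - 1 / 2 ^ J :: real) ^ (2 ^ J)"
        using J(1) by (intro one_minus_inverse_power_ge) (simp add: K_def)
      also have "\<dots> \<le> r ^ (2 ^ J)" by (rule power_mono[OF rJ]) simp
      also have "\<dots> \<le> r ^ (2 ^ k)" by (rule power_decreasing) (use k r in auto)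
      finally show "1 / (2 ^ k * \<omega> (1 - 1 / 2 ^ k)) \<le> 4 * (r ^ (2 ^ k) / (2 ^ k * \<omega> (1 - 1 / 2 ^ k)))"
        using wk[of k] by (simp add: field_simps)
    qed
    finally have "?I r \<le> ?I r0 + D * (\<Sum>k=K..J. 4 * (r ^ (2 ^ k) / (2 ^ k * \<omega> (1 - 1 / 2 ^ k))))"
      using \<open>0 \<le> D\<close> by (simp add: mult_left_mono)
    also have "\<dots> = ?I r0 + (4 * D) * (\<Sum>k=K..J. r ^ (2 ^ k) / (2 ^ k * \<omega> (1 - 1 / 2 ^ k)))"
      by (simp add: sum_distrib_left mult_ac)
    also have "\<dots> \<le> C2 + C2 * (\<Sum>k=K..J. r ^ (2 ^ k) / (2 ^ k * \<omega> (1 - 1 / 2 ^ k)))"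
      using r wk by (intro add_mono mult_right_mono sum_nonneg) (auto simp: C2_def less_imp_le)
    finally show ?thesis by blast
  qed
  show ?thesis
  proof (rule that[of "max C1 C2" K])
    show "0 \<le> max C1 C2" using \<open>0 \<le> C2\<close> by simp
    show "\<omega> r * (\<Sum>k=K..J. r ^ (2 ^ k) / \<omega> (1 - 1 / 2 ^ k)) \<le> max C1 C2" if "0 \<le> r" "r < 1" for J r
      using up'[OF that, of J] by simp
    fix r :: real assume r: "0 \<le> r" "r < 1"
    then obtain J where "?I r \<le> C2 + C2 * (\<Sum>k=K..J. r ^ (2 ^ k) / (2 ^ k * \<omega> (1 - 1 / 2 ^ k)))"
      using low by blast
    also have "\<dots> \<le> max C1 C2 + max C1 C2 * (\<Sum>k=K..J. r ^ (2 ^ k) / (2 ^ k * \<omega> (1 - 1 / 2 ^ k)))"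
      using r wk by (intro add_mono mult_right_mono sum_nonneg) (auto simp: less_imp_le)
    finally show "\<exists>J. ?I r \<le> max C1 C2 + max C1 C2 * (\<Sum>k=K..J. r ^ (2 ^ k) / (2 ^ k * \<omega> (1 - 1 / 2 ^ k)))"
      by blast
  qed
qed

section \<open>Boundedness of the extended Cesaro operator\<close>

text \<open>Euler's identity: a power of \<open>L\<close> is homogeneous, so the radial derivative
  multiplies it by its degree.\<close>

lemma functional_polynomial:
  fixes L :: "'a::complex_normed_vector \<Rightarrow> complex" and c :: "nat \<Rightarrow> complex" and e :: "nat \<Rightarrow> nat"
    and A :: "nat set"
  assumes bl: "bounded_linear L" and scale: "\<And>c x. L (scaleC c x) = c * L x"
  defines "f \<equiv> \<lambda>z. if z \<in> ball 0 1 then \<Sum>k\<in>A. c k * L z ^ e k else 0"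
  shows "f \<in> holo_ball"
    and "z \<in> ball 0 1 \<Longrightarrow> radial_deriv f z = (\<Sum>k\<in>A. c k * (of_nat (e k) * L z ^ e k))"
proof -
  have der: "(L has_derivative L) (at z)" for z
    using bl by (rule bounded_linear_imp_has_derivative)
  then have L: "holo_at L z" for z
    unfolding holo_at_def using scale by blast
  show "f \<in> holo_ball"
    unfolding holo_ball_iff
  proof (intro conjI ballI allI impI)
    fix z :: 'a assume z: "z \<in> ball 0 1"
    show "holo_at f z"
    proof (rule holo_at_transform[OF _ open_ball z])
      show "holo_at (\<lambda>z. \<Sum>k\<in>A. c k * L z ^ e k) z"
        by (intro holo_at_sum holo_at_cmult holo_at_power L)
    qed (simp add: f_def)
  qed (auto simp: f_def)
  assume z: "z \<in> ball 0 1"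
  have "((\<lambda>z. \<Sum>k\<in>A. c k * L z ^ e k) has_derivative
      (\<lambda>h. \<Sum>k\<in>A. c k * (of_nat (e k) * L h * L z ^ (e k - 1)))) (at z)"
    by (intro has_derivative_sum has_derivative_mult_right has_derivative_power der)
  then have "(f has_derivative (\<lambda>h. \<Sum>k\<in>A. c k * (of_nat (e k) * L h * L z ^ (e k - 1)))) (at z)"
    by (rule has_derivative_transform_within_open[OF _ open_ball z]) (simp add: f_def)
  from fun_cong[OF frechet_derivative_at[OF this], of z]
  have "radial_deriv f z = (\<Sum>k\<in>A. c k * (of_nat (e k) * L z * L z ^ (e k - 1)))"
    by (simp only: radial_deriv_def)
  also have "\<dots> = (\<Sum>k\<in>A. c k * (of_nat (e k) * L z ^ e k))"
  proof (rule sum.cong)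
    show "c k * (of_nat (e k) * L z * L z ^ (e k - 1)) = c k * (of_nat (e k) * L z ^ e k)" for k
      \<comment> \<open>For \<open>e k = 0\<close> the truncated \<open>e k - 1\<close> is 0 as
        well, and the factor \<open>e k\<close> makes both sides vanish.\<close>
      by (cases "e k") simp_all
  qed simp
  finally show "radial_deriv f z = (\<Sum>k\<in>A. c k * (of_nat (e k) * L z ^ e k))" .
qed

text \<open>The radial derivative is bounded on the ball, and the weight supplies the decay.\<close>

lemma functional_polynomial_little_bloch:
  fixes L :: "'a::complex_normed_vector \<Rightarrow> complex" and c :: "nat \<Rightarrow> complex" and e :: "nat \<Rightarrow> nat"
    and A :: "nat set"
  assumes \<omega>: "normal_fun \<omega>" and bl: "bounded_linear L" and scale: "\<And>c x. L (scaleC c x) = c * L x"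
    and le: "\<And>x. cmod (L x) \<le> norm x"
  shows "(\<lambda>z. if z \<in> ball 0 1 then \<Sum>k\<in>A. c k * L z ^ e k else 0) \<in> little_bloch \<omega>"
    (is "?f \<in> _")
proof (rule little_blochI)
  show pos: "\<forall>r\<in>{0..<1}. 0 < \<omega> r" using \<omega> by (simp add: normal_fun_def)
  show "?f \<in> holo_ball" by (rule functional_polynomial(1)[OF bl scale])
  define S where "S = (\<Sum>k\<in>A. cmod (c k) * real (e k))"
  have "0 \<le> S" by (simp add: S_def sum_nonneg)
  have S: "cmod (radial_deriv ?f z) \<le> S" if "norm z < 1" for z
  proof -
    have "cmod (L z) \<le> 1" using le[of z] that by simp
    have "radial_deriv ?f z = (\<Sum>k\<in>A. c k * (of_nat (e k) * L z ^ e k))"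
      using that by (intro functional_polynomial(2)[OF bl scale]) simp
    also have "cmod \<dots> \<le> (\<Sum>k\<in>A. cmod (c k * (of_nat (e k) * L z ^ e k)))" by (rule norm_sum)
    also have "\<dots> \<le> S"
      unfolding S_def norm_mult norm_power norm_of_nat using \<open>cmod (L z) \<le> 1\<close>
      by (intro sum_mono mult_left_mono mult_right_le_one_le power_le_one) auto
    finally show ?thesis .
  qed
  fix \<epsilon> :: real assume "0 < \<epsilon>"
  then have "\<forall>\<^sub>F t in at_left 1. \<omega> t < \<epsilon> / (S + 1)"
    using \<open>0 \<le> S\<close> by (intro order_tendstoD(2)[OF normal_fun_tendsto_0[OF \<omega>]]) simp
  then obtain r where r: "r < 1" "\<And>t. r < t \<Longrightarrow> t < 1 \<Longrightarrow> \<omega> t < \<epsilon> / (S + 1)"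
    by (auto simp: eventually_at_left[of 0])
  have "\<omega> (norm z) * cmod (radial_deriv ?f z) < \<epsilon>" if z: "r < norm z" "norm z < 1" for z
  proof -
    have "0 < \<omega> (norm z)" using pos z by simp
    then have "\<omega> (norm z) * cmod (radial_deriv ?f z) \<le> \<omega> (norm z) * (S + 1)"
      using S[OF z(2)] by (intro mult_left_mono) auto
    also have "\<dots> < \<epsilon>" using r(2)[OF z] \<open>0 \<le> S\<close> by (simp add: field_simps)
    finally show ?thesis .
  qed
  with r(1) show "\<exists>r<1. \<forall>z. r < norm z \<and> norm z < 1 \<longrightarrow> \<omega> (norm z) * cmod (radial_deriv ?f z) < \<epsilon>"
    by blast
qed

section \<open>The Bloch norm as a genuine supremum\<close>

lemma bloch_norm_upper:
  fixes f :: "'a::complex_normed_vector \<Rightarrow> complex"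
  assumes "normal_fun \<omega>" "f \<in> little_bloch \<omega>" "z \<in> ball 0 1"
  shows "cmod (f 0) + \<omega> (norm z) * cmod (radial_deriv f z) \<le> bloch_norm \<omega> f"
  unfolding bloch_norm_def using assms
  by (intro add_left_mono cSUP_upper little_bloch_bdd_above) (auto simp: normal_fun_def)

lemma bloch_norm_least:
  fixes f :: "'a::complex_normed_vector \<Rightarrow> complex"
  assumes "\<And>z. z \<in> ball 0 1 \<Longrightarrow> \<omega> (norm z) * cmod (radial_deriv f z) \<le> C"
  shows "bloch_norm \<omega> f \<le> cmod (f 0) + C"
  unfolding bloch_norm_def using assms by (intro add_left_mono cSUP_least) auto

lemma norm_le_bloch_norm:
  fixes f :: "'a::complex_normed_vector \<Rightarrow> complex"
  assumes "normal_fun \<omega>" "f \<in> little_bloch \<omega>"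
  shows "cmod (f 0) \<le> bloch_norm \<omega> f"
proof -
  have "0 < \<omega> 0" using assms by (simp add: normal_fun_def)
  then have "0 \<le> \<omega> (norm (0::'a)) * cmod (radial_deriv f 0)" by simp
  then show ?thesis using bloch_norm_upper[OF assms, of 0] by simp
qed

section \<open>Necessity and sufficiency\<close>

context
  fixes \<omega> \<mu> :: "real \<Rightarrow> real" and \<phi> :: "'a::complex_banach \<Rightarrow> complex"
  assumes \<omega>: "normal_fun \<omega>" and \<mu>: "normal_fun \<mu>" and \<phi>: "\<phi> \<in> holo_ball"
begin

lemma symbol_in_little_bloch:
  assumes T: "\<And>f. f \<in> little_bloch \<omega> \<Longrightarrow> cesaro_op \<phi> f \<in> little_bloch \<mu>"
  shows "\<phi> \<in> little_bloch \<mu>"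
proof -
  \<comment> \<open>The constant 1 on the ball, written with the zero functional and
    \<open>0 ^ 0 = 1\<close> to match the shape of functional polynomials.\<close>
  define one :: "'a \<Rightarrow> complex" where "one = (\<lambda>z. if z \<in> ball 0 1 then \<Sum>k\<in>{0::nat}. 1 * (0::complex) ^ 0 else 0)"
  have one: "one \<in> little_bloch \<omega>"
    unfolding one_def by (rule functional_polynomial_little_bloch[OF \<omega>]) simp_all
  then have T1: "cesaro_op \<phi> one \<in> little_bloch \<mu>" by (rule T)
  have R: "radial_deriv (cesaro_op \<phi> one) z = radial_deriv \<phi> z" if "norm z < 1" for z
    using radial_deriv_cesaro_op[OF _ \<phi>, of one z] one that by (simp add: little_bloch_def one_def)
  show ?thesis
  proof (rule little_blochI[OF \<phi>])
    show "\<forall>r\<in>{0..<1}. 0 < \<mu> r" using \<mu> by (simp add: normal_fun_def)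
    fix e :: real assume "0 < e"
    obtain r where "1/2 \<le> r" "r < 1"
      "\<And>z. r \<le> norm z \<Longrightarrow> norm z < 1 \<Longrightarrow> \<mu> (norm z) * cmod (radial_deriv (cesaro_op \<phi> one) z) < e"
      by (rule little_bloch_small[OF T1 \<open>0 < e\<close>]) (rule that)
    then show "\<exists>r<1. \<forall>z. r < norm z \<and> norm z < 1 \<longrightarrow> \<mu> (norm z) * cmod (radial_deriv \<phi> z) < e"
      using R by (intro exI[of _ r]) auto
  qed
qed

text \<open>At \<open>w\<close> the functional reproduces \<open>norm w\<close>, so the test
  function takes the value of the radial sum; elsewhere it is dominated by that sum at
  \<open>norm z\<close>. The product rule for the operator at \<open>w\<close> bounds the sum, and
  the additive constant left from the integral is absorbed because the weighted derivative of \<phi>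
  is bounded.\<close>

lemma integral_condition_necessary:
  assumes \<phi>\<mu>: "\<phi> \<in> little_bloch \<mu>"
    and T: "\<And>f. f \<in> little_bloch \<omega> \<Longrightarrow> cesaro_op \<phi> f \<in> little_bloch \<mu>"
    and bnd: "\<And>f. f \<in> little_bloch \<omega> \<Longrightarrow> bloch_norm \<mu> (cesaro_op \<phi> f) \<le> C0 * bloch_norm \<omega> f"
  shows "bdd_above ((\<lambda>z. \<mu> (norm z) * cmod (radial_deriv \<phi> z) *
            integral {0..norm z} (\<lambda>t. 1 / \<omega> t)) ` ball 0 1)"
proof -
  have posw: "\<forall>r\<in>{0..<1}. 0 < \<omega> r" and posm: "\<forall>r\<in>{0..<1}. 0 < \<mu> r"
    using \<omega> \<mu> by (simp_all add: normal_fun_def)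
  obtain K C where C: "0 \<le> C"
    "\<And>J r. 0 \<le> r \<Longrightarrow> r < 1 \<Longrightarrow> \<omega> r * (\<Sum>k=K..J. r ^ (2 ^ k) / \<omega> (1 - 1 / 2 ^ k)) \<le> C"
    "\<And>r. 0 \<le> r \<Longrightarrow> r < 1 \<Longrightarrow> \<exists>J. integral {0..r} (\<lambda>t. 1 / \<omega> t)
       \<le> C + C * (\<Sum>k=K..J. r ^ (2 ^ k) / (2 ^ k * \<omega> (1 - 1 / 2 ^ k)))"
    by (rule lacunary_sum_bounds[OF \<omega>]) (rule that)
  have wk: "0 < \<omega> (1 - 1 / 2 ^ k)" for k using posw by simp
  define M where "M = bloch_norm \<mu> \<phi>"
  have "\<mu> (norm w) * cmod (radial_deriv \<phi> w) * integral {0..norm w} (\<lambda>t. 1 / \<omega> t) \<le> C * M + C * (\<bar>C0\<bar> * C)"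
    if w: "w \<in> ball 0 1" for w
  proof -
    obtain L :: "'a \<Rightarrow> complex" where L: "bounded_linear L" "\<And>c x. L (scaleC c x) = c * L x"
      "\<And>x. cmod (L x) \<le> norm x" "L w = norm w"
      by (rule exists_norming_functional[of w]) (rule that)
    obtain J where J: "integral {0..norm w} (\<lambda>t. 1 / \<omega> t)
       \<le> C + C * (\<Sum>k=K..J. norm w ^ (2 ^ k) / (2 ^ k * \<omega> (1 - 1 / 2 ^ k)))"
      using C(3)[of "norm w"] w by auto
    define S where "S = (\<Sum>k=K..J. norm w ^ (2 ^ k) / (2 ^ k * \<omega> (1 - 1 / 2 ^ k)))"
    have "0 \<le> S" using wk by (simp add: S_def sum_nonneg less_imp_le)
    \<comment> \<open>The factor \<open>2 ^ k\<close> in the denominator cancels the exponent that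
      the radial derivative brings down.\<close>
    define c where "c k = complex_of_real (1 / (2 ^ k * \<omega> (1 - 1 / 2 ^ k)))" for k
    define f where "f = (\<lambda>z. if z \<in> ball 0 1 then \<Sum>k\<in>{K..J}. c k * L z ^ (2 ^ k) else 0)"
    have f: "f \<in> little_bloch \<omega>"
      unfolding f_def by (rule functional_polynomial_little_bloch[OF \<omega> L(1,2,3)])
    then have fh: "f \<in> holo_ball" by (simp add: little_bloch_def)
    have "f 0 = 0"
      using linear_0[OF bounded_linear.linear[OF L(1)]] by (simp add: f_def power_0_left)
    have fw: "f w = of_real S"
      using w by (simp add: f_def L(4) c_def S_def)
    have Rf: "\<omega> (norm z) * cmod (radial_deriv f z) \<le> C" if z: "z \<in> ball 0 1" for z
    proof -
      have "radial_deriv f z = (\<Sum>k\<in>{K..J}. c k * (of_nat (2 ^ k) * L z ^ (2 ^ k)))"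
        unfolding f_def by (rule functional_polynomial(2)[OF L(1,2) z])
      also have "cmod \<dots> \<le> (\<Sum>k\<in>{K..J}. cmod (c k * (of_nat (2 ^ k) * L z ^ (2 ^ k))))"
        by (rule norm_sum)
      also have "\<dots> = (\<Sum>k\<in>{K..J}. cmod (L z) ^ (2 ^ k) / \<omega> (1 - 1 / 2 ^ k))"
        using wk by (intro sum.cong) (simp_all add: c_def norm_mult norm_divide norm_power less_imp_le)
      also have "\<dots> \<le> (\<Sum>k\<in>{K..J}. norm z ^ (2 ^ k) / \<omega> (1 - 1 / 2 ^ k))"
        using wk L(3) by (intro sum_mono divide_right_mono power_mono) (auto simp: less_imp_le)
      finally have "\<omega> (norm z) * cmod (radial_deriv f z)
          \<le> \<omega> (norm z) * (\<Sum>k\<in>{K..J}. norm z ^ (2 ^ k) / \<omega> (1 - 1 / 2 ^ k))"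
        using posw z by (intro mult_left_mono) (auto simp: less_imp_le)
      also have "\<dots> \<le> C" using z by (intro C(2)) auto
      finally show ?thesis .
    qed
    have N: "0 \<le> bloch_norm \<omega> f" "bloch_norm \<omega> f \<le> C"
      using norm_le_bloch_norm[OF \<omega> f] bloch_norm_least[of \<omega> f, OF Rf] \<open>f 0 = 0\<close> by simp_all
    define m where "m = \<mu> (norm w) * cmod (radial_deriv \<phi> w)"
    have "0 \<le> m" using posm w by (simp add: m_def less_imp_le)
    have "m * S = \<mu> (norm w) * cmod (radial_deriv (cesaro_op \<phi> f) w)"
      using \<open>0 \<le> S\<close> by (simp add: radial_deriv_cesaro_op[OF fh \<phi> w] fw m_def norm_mult)
    also have "\<dots> \<le> bloch_norm \<mu> (cesaro_op \<phi> f)"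
      using bloch_norm_upper[OF \<mu> T[OF f] w] by (simp add: cesaro_op_0[OF \<phi>])
    also have "\<dots> \<le> C0 * bloch_norm \<omega> f" by (rule bnd[OF f])
    \<comment> \<open>No sign of \<open>C0\<close> is known, hence the absolute value.\<close>
    also have "\<dots> \<le> \<bar>C0\<bar> * C" using N by (intro mult_mono) auto
    finally have mS: "m * S \<le> \<bar>C0\<bar> * C" .
    have mM: "m \<le> M"
      using bloch_norm_upper[OF \<mu> \<phi>\<mu> w] norm_ge_zero[of "\<phi> 0"] unfolding m_def M_def by linarith
    have "m * integral {0..norm w} (\<lambda>t. 1 / \<omega> t) \<le> m * (C + C * S)"
      using J \<open>0 \<le> m\<close> by (intro mult_left_mono) (simp_all add: S_def)
    also have "\<dots> = C * m + C * (m * S)" by (simp add: algebra_simps)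
    also have "\<dots> \<le> C * M + C * (\<bar>C0\<bar> * C)"
      using mS mM C(1) by (intro add_mono mult_left_mono) auto
    finally show ?thesis by (simp add: m_def)
  qed
  then show ?thesis by (rule bdd_aboveI2)
qed

lemma cesaro_op_bounded:
  assumes \<phi>\<mu>: "\<phi> \<in> little_bloch \<mu>"
    and bdd: "bdd_above ((\<lambda>z. \<mu> (norm z) * cmod (radial_deriv \<phi> z) *
            integral {0..norm z} (\<lambda>t. 1 / \<omega> t)) ` ball 0 1)"
  shows "bounded_operator_on (little_bloch \<omega>) (bloch_norm \<omega>) (little_bloch \<mu>) (bloch_norm \<mu>) (cesaro_op \<phi>)"
proof -
  have posw: "\<forall>r\<in>{0..<1}. 0 < \<omega> r" and posm: "\<forall>r\<in>{0..<1}. 0 < \<mu> r"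
    and contw: "continuous_on {0..<1} \<omega>"
    using \<omega> \<mu> by (simp_all add: normal_fun_def)
  let ?I = "\<lambda>r. integral {0..r} (\<lambda>t. 1 / \<omega> t)"
  define m where "m z = \<mu> (norm z) * cmod (radial_deriv \<phi> z)" for z
  have m_nonneg: "0 \<le> m z" if "z \<in> ball 0 1" for z
    using posm that by (simp add: m_def less_imp_le)
  obtain A where A: "\<And>z. z \<in> ball 0 1 \<Longrightarrow> m z * ?I (norm z) \<le> A"
    using bdd unfolding bdd_above_def m_def by fastforce
  have "0 \<le> A" using A[of 0] by simp
  define M where "M = bloch_norm \<mu> \<phi>"
  have "0 \<le> M"
    using norm_le_bloch_norm[OF \<mu> \<phi>\<mu>] norm_ge_zero order_trans unfolding M_def by blast
  have M: "m z \<le> M" if "z \<in> ball 0 1" for z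
    using bloch_norm_upper[OF \<mu> \<phi>\<mu> that] norm_ge_zero[of "\<phi> 0"] unfolding m_def M_def by linarith
  obtain C where C: "0 \<le> C" "\<And>(f :: 'a \<Rightarrow> complex) B (z::'a). f \<in> holo_ball \<Longrightarrow>
       (\<forall>y\<in>ball 0 1. \<omega> (norm y) * cmod (radial_deriv f y) \<le> B) \<Longrightarrow>
       z \<in> ball 0 1 \<Longrightarrow> cmod (f z) \<le> cmod (f 0) + C * B * ?I (norm z)"
    by (rule bloch_growth[OF contw posw]) (rule that)
  \<comment> \<open>\<open>M\<close> accounts for the contribution of \<open>f 0\<close>, and
    \<open>C * A\<close> for the growth of \<open>f\<close> along the ray.\<close>
  have main: "cesaro_op \<phi> f \<in> little_bloch \<mu> \<and> bloch_norm \<mu> (cesaro_op \<phi> f) \<le> (M + C * A) * bloch_norm \<omega> f"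
    if f: "f \<in> little_bloch \<omega>" for f
  proof
    have fh: "f \<in> holo_ball" using f by (simp add: little_bloch_def)
    define N where "N = bloch_norm \<omega> f"
    have f0: "cmod (f 0) \<le> N" unfolding N_def by (rule norm_le_bloch_norm[OF \<omega> f])
    then have "0 \<le> N" using norm_ge_zero order_trans by blast
    have N: "\<forall>y\<in>ball 0 1. \<omega> (norm y) * cmod (radial_deriv f y) \<le> N"
    proof
      fix y :: 'a assume "y \<in> ball 0 1"
      from bloch_norm_upper[OF \<omega> f this] show "\<omega> (norm y) * cmod (radial_deriv f y) \<le> N"
        using norm_ge_zero[of "f 0"] unfolding N_def by linarith
    qed
    have R: "\<mu> (norm z) * cmod (radial_deriv (cesaro_op \<phi> f) z) = m z * cmod (f z)"
      if "z \<in> ball 0 1" for z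
      by (simp add: radial_deriv_cesaro_op[OF fh \<phi> that] m_def norm_mult)
    have "m z * cmod (f z) \<le> (M + C * A) * N" if z: "z \<in> ball 0 1" for z
    proof -
      have "m z * cmod (f z) \<le> m z * (cmod (f 0) + C * N * ?I (norm z))"
        using C(2)[OF fh N z] m_nonneg[OF z] by (rule mult_left_mono)
      also have "\<dots> = m z * cmod (f 0) + C * N * (m z * ?I (norm z))" by (simp add: algebra_simps)
      also have "\<dots> \<le> M * N + C * N * A"
        using M[OF z] f0 A[OF z] \<open>0 \<le> M\<close> \<open>0 \<le> N\<close> C(1) by (intro add_mono mult_mono mult_left_mono) auto
      finally show ?thesis by (simp add: algebra_simps)
    qed
    then show "bloch_norm \<mu> (cesaro_op \<phi> f) \<le> (M + C * A) * bloch_norm \<omega> f"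
      using bloch_norm_least[of \<mu> "cesaro_op \<phi> f"] R by (simp add: cesaro_op_0[OF \<phi>] N_def)
    show "cesaro_op \<phi> f \<in> little_bloch \<mu>"
    proof (rule little_blochI[OF cesaro_op_holo_ball[OF fh \<phi>] posm])
      fix e :: real assume "0 < e"
      \<comment> \<open>Chosen so that \<open>2 * e1 * A < e / 2\<close>; the added 1 covers
        \<open>A = 0\<close>.\<close>
      define e1 where "e1 = e / (2 * (2 * A + 1))"
      have "0 < e1" using \<open>0 < e\<close> \<open>0 \<le> A\<close> by (simp add: e1_def)
      obtain r where r: "1/2 \<le> r" "r < 1"
        "\<And>z. r \<le> norm z \<Longrightarrow> norm z < 1 \<Longrightarrow> \<omega> (norm z) * cmod (radial_deriv f z) < e1"
        by (rule little_bloch_small[OF f \<open>0 < e1\<close>]) (rule that)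
      \<comment> \<open>A bound for \<open>f\<close> on the whole sphere of radius \<open>r\<close>.
        It does not depend on \<open>z\<close>, so the decay of \<open>m z\<close> defeats
        it.\<close>
      define G where "G = cmod (f 0) + C * N * ?I r"
      have "0 \<le> ?I r" by (rule integral_reciprocal_nonneg[OF contw posw r(2)])
      then have "0 \<le> G" using C(1) \<open>0 \<le> N\<close> by (simp add: G_def)
      have "0 < e / (2 * (G + 1))" using \<open>0 < e\<close> \<open>0 \<le> G\<close> by simp
      then obtain r' where r': "1/2 \<le> r'" "r' < 1"
        "\<And>z. r' \<le> norm z \<Longrightarrow> norm z < 1 \<Longrightarrow> \<mu> (norm z) * cmod (radial_deriv \<phi> z) < e / (2 * (G + 1))"
        by (rule little_bloch_small[OF \<phi>\<mu>]) (rule that)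
      have "\<mu> (norm z) * cmod (radial_deriv (cesaro_op \<phi> f) z) < e"
        if z: "max r r' < norm z" "norm z < 1" for z
      proof -
        have zb: "z \<in> ball 0 1" using z by simp
        have "z \<noteq> 0" using z r by auto
        then obtain u where u: "norm u = 1" "z = norm z *\<^sub>R u" by (rule exists_unit_direction)
        \<comment> \<open>Beyond radius \<open>r\<close> the weighted radial derivative is below
          \<open>e1\<close>; passing to the derivative in direction \<open>u\<close> divides by
          \<open>x \<ge> 1/2\<close>, hence the factor \<open>2 * e1\<close>.\<close>
        have "cmod (f (norm z *\<^sub>R u) - f (r *\<^sub>R u)) \<le> (2 * e1) * ?I (norm z) - (2 * e1) * ?I r"
        proof (rule ray_growth[OF fh contw posw _ _ z(2) u(1)])
          fix x assume x: "r < x" "x < norm z"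
          have "holo_at f (x *\<^sub>R u)" using fh x z r u by (simp add: holo_ball_iff)
          then have eq: "cmod (radial_deriv f (x *\<^sub>R u)) = x * cmod (frechet_derivative f (at (x *\<^sub>R u)) u)"
            using x r by (simp add: radial_deriv_scaleR norm_mult)
          have wx: "0 < \<omega> x" using posw x r z by simp
          have "\<omega> x * (1/2 * cmod (frechet_derivative f (at (x *\<^sub>R u)) u))
              \<le> \<omega> x * cmod (radial_deriv f (x *\<^sub>R u))"
            unfolding eq using x r wx by (intro mult_left_mono mult_right_mono) auto
          also have "\<dots> \<le> e1" using r(3)[of "x *\<^sub>R u"] x r u z by simp
          finally show "cmod (frechet_derivative f (at (x *\<^sub>R u)) u) \<le> 2 * e1 / \<omega> x"
            using wx by (simp add: field_simps)
        qed (use r z in auto)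
        also have "\<dots> \<le> (2 * e1) * ?I (norm z)" using \<open>0 \<le> ?I r\<close> \<open>0 < e1\<close> by simp
        finally have "cmod (f z) \<le> cmod (f (r *\<^sub>R u)) + (2 * e1) * ?I (norm z)"
          using u(2)[symmetric] norm_triangle_ineq2[of "f z" "f (r *\<^sub>R u)"] by simp
        moreover have "cmod (f (r *\<^sub>R u)) \<le> G"
          using C(2)[OF fh N, of "r *\<^sub>R u"] r u by (simp add: G_def)
        ultimately have "m z * cmod (f z) \<le> m z * (G + (2 * e1) * ?I (norm z))"
          using m_nonneg[OF zb] by (intro mult_left_mono) auto
        also have "\<dots> = m z * G + 2 * e1 * (m z * ?I (norm z))" by (simp add: algebra_simps)
        also have "\<dots> \<le> e / (2 * (G + 1)) * G + 2 * e1 * A"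
          using A[OF zb] r'(3)[of z] z \<open>0 \<le> G\<close> \<open>0 < e1\<close>
          by (intro add_mono mult_right_mono mult_left_mono) (auto simp: m_def)
        also have "\<dots> < e / 2 + e / 2"
        proof (rule add_strict_mono)
          show "e / (2 * (G + 1)) * G < e / 2" using \<open>0 < e\<close> \<open>0 \<le> G\<close> by (simp add: field_simps)
          show "2 * e1 * A < e / 2" using \<open>0 < e\<close> \<open>0 \<le> A\<close> by (simp add: e1_def field_simps)
        qed
        finally show ?thesis using R[OF zb] by simp
      qed
      moreover have "max r r' < 1" using r r' by simp
      ultimately show "\<exists>r<1. \<forall>z. r < norm z \<and> norm z < 1 \<longrightarrow>
          \<mu> (norm z) * cmod (radial_deriv (cesaro_op \<phi> f) z) < e"
        by blast
    qed
  qed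
  show ?thesis
    unfolding bounded_operator_on_def
  proof (intro conjI ballI allI exI[of _ "M + C * A"])
    fix f g :: "'a \<Rightarrow> complex" assume "f \<in> little_bloch \<omega>" "g \<in> little_bloch \<omega>"
    then show "cesaro_op \<phi> (\<lambda>z. f z + g z) = (\<lambda>z. cesaro_op \<phi> f z + cesaro_op \<phi> g z)"
      by (intro cesaro_op_add \<phi>) (simp_all add: little_bloch_def)
  qed (use main cesaro_op_cmult[OF \<phi>] in blast)+
qed

end

theorem theorem3p3:
  fixes \<omega> \<mu> :: "real \<Rightarrow> real" and \<phi> :: "'a::complex_banach \<Rightarrow> complex"
  assumes "normal_fun \<omega>" and "normal_fun \<mu>" and "\<phi> \<in> holo_ball"
  shows "bounded_operator_on (little_bloch \<omega>) (bloch_norm \<omega>)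
           (little_bloch \<mu>) (bloch_norm \<mu>) (cesaro_op \<phi>) \<longleftrightarrow>
         \<phi> \<in> little_bloch \<mu> \<and>
         bdd_above ((\<lambda>z. \<mu> (norm z) * cmod (radial_deriv \<phi> z) *
                          integral {0..norm z} (\<lambda>t. 1 / \<omega> t)) ` ball 0 1)"
proof
  assume B: "bounded_operator_on (little_bloch \<omega>) (bloch_norm \<omega>)
           (little_bloch \<mu>) (bloch_norm \<mu>) (cesaro_op \<phi>)"
  then have T: "\<And>f. f \<in> little_bloch \<omega> \<Longrightarrow> cesaro_op \<phi> f \<in> little_bloch \<mu>"
    and "\<exists>C. \<forall>f\<in>little_bloch \<omega>. bloch_norm \<mu> (cesaro_op \<phi> f) \<le> C * bloch_norm \<omega> f"
    unfolding bounded_operator_on_def by blast+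
  then obtain C where C: "\<And>f. f \<in> little_bloch \<omega> \<Longrightarrow> bloch_norm \<mu> (cesaro_op \<phi> f) \<le> C * bloch_norm \<omega> f"
    by blast
  have \<phi>: "\<phi> \<in> little_bloch \<mu>" by (rule symbol_in_little_bloch[OF assms]) (rule T)
  have "bdd_above ((\<lambda>z. \<mu> (norm z) * cmod (radial_deriv \<phi> z) *
                          integral {0..norm z} (\<lambda>t. 1 / \<omega> t)) ` ball 0 1)"
    by (rule integral_condition_necessary[OF assms \<phi>, where ?C0.0 = C]) (fact T C)+
  with \<phi> show "\<phi> \<in> little_bloch \<mu> \<and> bdd_above ((\<lambda>z. \<mu> (norm z) * cmod (radial_deriv \<phi> z) *
                          integral {0..norm z} (\<lambda>t. 1 / \<omega> t)) ` ball 0 1)" by blast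
qed (use cesaro_op_bounded[OF assms] in blast)

end
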